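(* Let $L$ be a logic above $\mathbf{S4}$. The following are equivalent. (1) $L$ is connected. (2) $L$ is the logic of a countable path-connected general $\mathbf{S4}$-frame. (3) $L$ is the logic of a countable connected general space. (4) $L$ is the logic of a general space over the real line $\mathbf{R}$. (5) $L=L(\mathfrak{A})$ for some subalgebra $\mathfrak{A}$ of the closure algebra $\mathbf{R}^+$.
   Context: Modal formulas are built from a countably infinite set of propositional letters using the Boolean connectives, $\top,\bot$, and the unary operators $\Diamond,\Box$. A normal modal logic is a set of modal formulas containing all tautologies, all instances of $\Diamond(\varphi\vee\psi)\leftrightarrow(\Diamond\varphi\vee\Diamond\psi)$ and $\Box\varphi\leftrightarrow\neg\Diamond\neg\varphi$, and $\Diamond\bot\leftrightarrow\bot$, and closed under Modus Ponens, Necessitation ($\varphi/\Box\varphi$) and uniform substitution. $\mathbf{S4}$ is the least normal modal logic containing all instances of $\Diamond\Diamond\varphi\to\Diamond\varphi$ and $\varphi\to\Diamond\varphi$. A logic above $\mathbf{S4}$ is a normal modal logic containing $\mathbf{S4}$. A modal algebra is a Boolean algebra $A$ with a unary $\Diamond$ satisfying $\Diamond(a\vee b)=\Diamond a\vee\Diamond b$ and $\Diamond 0=0$; $\Box a=\neg\Diamond\neg a$. It is a closure algebra if $a\le\Diamond a$ and $\Diamond\Diamond a\le\Diamond a$ for all $a$. A formula is valid in a modal algebra if, read as a polynomial, it evaluates to $1$ under every assignment; $L(\mathfrak{A})$ is the set of formulas valid in $\mathfrak{A}$. A closure algebra is connected if its only elements $a$ with $\Box a=a=\Diamond a$ are $0$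 and $1$. A logic $L$ above $\mathbf{S4}$ is connected if $L=L(\mathfrak{A})$ for some connected closure algebra $\mathfrak{A}$. For a topological space $X$ with closure operator $\mathbf{c}$, $X^+=(\wp(X),\mathbf{c})$ is its closure algebra. A general space is a pair $(X,\mathcal{P})$ with $X$ a topological space and $\mathcal{P}$ a subalgebra of $X^+$ (it is a general space over $X$); its logic is $L(\mathcal{P})$. It is countable (connected) if the topological space $X$ is countable (connected). For a Kripke frame $(W,R)$ ($R$ a binary relation on the set $W$), $(W,R)^+=(\wp(W),R^{-1})$, where $R^{-1}(U)=\{w: wRv\text{ for some }v\in U\}$. A general $\mathbf{S4}$-frame is a triple $(W,R,\mathcal{P})$ with $R$ reflexive and transitive on $W$ and $\mathcal{P}$ a subalgebra of $(W,R)^+$; its logic is $L(\mathcal{P})$. It is countable if $W$ is countable, and path-connected if any two points of $W$ are joined by a finite sequence of points in which any two consecutive points $u,v$ satisfy $uRv$ or $vRu$. "Countable" means finite or countably infinite. $\mathbf{R}$ has its usual topology.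
   Formalization: Algebras are taken with 0 ≠ 1 and frames and spaces nonempty; otherwise the inconsistent logic satisfies (1)–(3), via the one-element algebra, empty frame and empty space, but not (4) or (5). For consistent L this changes nothing. *)

theory Defs
  imports "HOL-Analysis.Analysis" "HOL-Library.Infinite_Typeclass"
begin

section \<open>Modal logics\<close>

datatype fm =
    Atom nat
  | Top
  | Bot
  | Neg fm
  | Con fm fm
  | Dis fm fm
  | Imp fm fm
  | Dia fm
  | Box fm

definition Iff :: "fm \<Rightarrow> fm \<Rightarrow> fm" where
  "Iff p q = Con (Imp p q) (Imp q p)"

primrec subst :: "(nat \<Rightarrow> fm) \<Rightarrow> fm \<Rightarrow> fm" where
  "subst s (Atom n) = s n"
| "subst s Top = Top"
| "subst s Bot = Bot"
| "subst s (Neg p) = Neg (subst s p)"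
| "subst s (Con p q) = Con (subst s p) (subst s q)"
| "subst s (Dis p q) = Dis (subst s p) (subst s q)"
| "subst s (Imp p q) = Imp (subst s p) (subst s q)"
| "subst s (Dia p) = Dia (subst s p)"
| "subst s (Box p) = Box (subst s p)"

text \<open>A tautology of the modal language is true under every truth assignment to the letters and
  to the formulas whose outermost symbol is a modality.\<close>

primrec truth :: "(fm \<Rightarrow> bool) \<Rightarrow> fm \<Rightarrow> bool" where
  "truth v (Atom n) \<longleftrightarrow> v (Atom n)"
| "truth v Top \<longleftrightarrow> True"
| "truth v Bot \<longleftrightarrow> False"
| "truth v (Neg p) \<longleftrightarrow> \<not> truth v p"
| "truth v (Con p q) \<longleftrightarrow> truth v p \<and> truth v q"
| "truth v (Dis p q) \<longleftrightarrow> truth v p \<or> truth v q"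
| "truth v (Imp p q) \<longleftrightarrow> (truth v p \<longrightarrow> truth v q)"
| "truth v (Dia p) \<longleftrightarrow> v (Dia p)"
| "truth v (Box p) \<longleftrightarrow> v (Box p)"

definition tautology :: "fm \<Rightarrow> bool" where
  "tautology p \<longleftrightarrow> (\<forall>v. truth v p)"

definition normal_modal_logic :: "fm set \<Rightarrow> bool" where
  "normal_modal_logic L \<longleftrightarrow>
     (\<forall>p. tautology p \<longrightarrow> p \<in> L) \<and>
     (\<forall>p q. Iff (Dia (Dis p q)) (Dis (Dia p) (Dia q)) \<in> L) \<and>
     (\<forall>p. Iff (Box p) (Neg (Dia (Neg p))) \<in> L) \<and>
     Iff (Dia Bot) Bot \<in> L \<and>
     (\<forall>p q. p \<in> L \<longrightarrow> Imp p q \<in> L \<longrightarrow> q \<in> L) \<and>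
     (\<forall>p. p \<in> L \<longrightarrow> Box p \<in> L) \<and>
     (\<forall>p s. p \<in> L \<longrightarrow> subst s p \<in> L)"

definition S4 :: "fm set" where
  "S4 = \<Inter>{L. normal_modal_logic L \<and>
              (\<forall>p. Imp (Dia (Dia p)) (Dia p) \<in> L) \<and>
              (\<forall>p. Imp p (Dia p) \<in> L)}"

definition logic_above_S4 :: "fm set \<Rightarrow> bool" where
  "logic_above_S4 L \<longleftrightarrow> normal_modal_logic L \<and> S4 \<subseteq> L"


section \<open>Modal algebras\<close>

record 'a modal_alg =
  carrier :: "'a set"
  join :: "'a \<Rightarrow> 'a \<Rightarrow> 'a"
  meet :: "'a \<Rightarrow> 'a \<Rightarrow> 'a"
  compl :: "'a \<Rightarrow> 'a"
  zero :: 'a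
  one :: 'a
  dia :: "'a \<Rightarrow> 'a"

definition box :: "'a modal_alg \<Rightarrow> 'a \<Rightarrow> 'a" where
  "box A a = compl A (dia A (compl A a))"

definition leq :: "'a modal_alg \<Rightarrow> 'a \<Rightarrow> 'a \<Rightarrow> bool" where
  "leq A a b \<longleftrightarrow> join A a b = b"

text \<open>The axioms are those of the locale \<open>abstract_boolean_algebra\<close>, relativised to the carrier.
  Boolean algebras are nondegenerate, i.e. \<open>0 \<noteq> 1\<close>; accordingly Kripke frames and
  topological spaces are nonempty below. Without this convention the inconsistent logic would be
  the logic of the (connected) one-element closure algebra, but it is not the logic of any
  subalgebra of the closure algebra of the real line. For consistent logics the convention makes
  no difference.\<close>

definition boolean_alg :: "'a modal_alg \<Rightarrow> bool" where
  "boolean_alg A \<longleftrightarrow>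
     zero A \<in> carrier A \<and> one A \<in> carrier A \<and> zero A \<noteq> one A \<and>
     (\<forall>a\<in>carrier A. compl A a \<in> carrier A) \<and>
     (\<forall>a\<in>carrier A. \<forall>b\<in>carrier A. join A a b \<in> carrier A \<and> meet A a b \<in> carrier A) \<and>
     (\<forall>a\<in>carrier A. \<forall>b\<in>carrier A. \<forall>c\<in>carrier A.
        join A (join A a b) c = join A a (join A b c) \<and>
        meet A (meet A a b) c = meet A a (meet A b c)) \<and>
     (\<forall>a\<in>carrier A. \<forall>b\<in>carrier A. join A a b = join A b a \<and> meet A a b = meet A b a) \<and>
     (\<forall>a\<in>carrier A. \<forall>b\<in>carrier A. \<forall>c\<in>carrier A.
        meet A a (join A b c) = join A (meet A a b) (meet A a c) \<and>
        join A a (meet A b c) = meet A (join A a b) (join A a c)) \<and>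
     (\<forall>a\<in>carrier A. join A a (zero A) = a \<and> meet A a (one A) = a) \<and>
     (\<forall>a\<in>carrier A. join A a (compl A a) = one A \<and> meet A a (compl A a) = zero A)"

definition modal_algebra :: "'a modal_alg \<Rightarrow> bool" where
  "modal_algebra A \<longleftrightarrow>
     boolean_alg A \<and>
     (\<forall>a\<in>carrier A. dia A a \<in> carrier A) \<and>
     (\<forall>a\<in>carrier A. \<forall>b\<in>carrier A. dia A (join A a b) = join A (dia A a) (dia A b)) \<and>
     dia A (zero A) = zero A"

definition closure_algebra :: "'a modal_alg \<Rightarrow> bool" where
  "closure_algebra A \<longleftrightarrow>
     modal_algebra A \<and>
     (\<forall>a\<in>carrier A. leq A a (dia A a)) \<and>
     (\<forall>a\<in>carrier A. leq A (dia A (dia A a)) (dia A a))"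

definition connected_alg :: "'a modal_alg \<Rightarrow> bool" where
  "connected_alg A \<longleftrightarrow> (\<forall>a\<in>carrier A. box A a = a \<and> dia A a = a \<longrightarrow> a = zero A \<or> a = one A)"

definition subalgebra :: "'a set \<Rightarrow> 'a modal_alg \<Rightarrow> bool" where
  "subalgebra P A \<longleftrightarrow>
     P \<subseteq> carrier A \<and> zero A \<in> P \<and> one A \<in> P \<and>
     (\<forall>a\<in>P. compl A a \<in> P \<and> dia A a \<in> P) \<and>
     (\<forall>a\<in>P. \<forall>b\<in>P. join A a b \<in> P \<and> meet A a b \<in> P)"

definition restrict_alg :: "'a modal_alg \<Rightarrow> 'a set \<Rightarrow> 'a modal_alg" where
  "restrict_alg A P = A\<lparr>carrier := P\<rparr>"

primrec eval_fm :: "'a modal_alg \<Rightarrow> (nat \<Rightarrow> 'a) \<Rightarrow> fm \<Rightarrow> 'a" where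
  "eval_fm A v (Atom n) = v n"
| "eval_fm A v Top = one A"
| "eval_fm A v Bot = zero A"
| "eval_fm A v (Neg p) = compl A (eval_fm A v p)"
| "eval_fm A v (Con p q) = meet A (eval_fm A v p) (eval_fm A v q)"
| "eval_fm A v (Dis p q) = join A (eval_fm A v p) (eval_fm A v q)"
| "eval_fm A v (Imp p q) = join A (compl A (eval_fm A v p)) (eval_fm A v q)"
| "eval_fm A v (Dia p) = dia A (eval_fm A v p)"
| "eval_fm A v (Box p) = box A (eval_fm A v p)"

definition valid_in :: "'a modal_alg \<Rightarrow> fm \<Rightarrow> bool" where
  "valid_in A p \<longleftrightarrow> (\<forall>v. (\<forall>n. v n \<in> carrier A) \<longrightarrow> eval_fm A v p = one A)"

definition logic_of :: "'a modal_alg \<Rightarrow> fm set" where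
  "logic_of A = {p. valid_in A p}"

definition powerset_alg :: "'a set \<Rightarrow> ('a set \<Rightarrow> 'a set) \<Rightarrow> 'a set modal_alg" where
  "powerset_alg X f =
     \<lparr>carrier = Pow X, join = (\<union>), meet = (\<inter>), compl = (\<lambda>U. X - U),
      zero = {}, one = X, dia = f\<rparr>"


section \<open>General spaces and general frames\<close>

definition space_alg :: "'a topology \<Rightarrow> 'a set modal_alg" where
  "space_alg X = powerset_alg (topspace X) (\<lambda>U. X closure_of U)"

definition general_space :: "'a topology \<Rightarrow> 'a set set \<Rightarrow> bool" where
  "general_space X P \<longleftrightarrow> topspace X \<noteq> {} \<and> subalgebra P (space_alg X)"

definition space_logic :: "'a topology \<Rightarrow> 'a set set \<Rightarrow> fm set" where
  "space_logic X P = logic_of (restrict_alg (space_alg X) P)"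

definition frame_alg :: "'a set \<Rightarrow> 'a rel \<Rightarrow> 'a set modal_alg" where
  "frame_alg W R = powerset_alg W (\<lambda>U. R\<inverse> `` U)"

definition general_S4_frame :: "'a set \<Rightarrow> 'a rel \<Rightarrow> 'a set set \<Rightarrow> bool" where
  "general_S4_frame W R P \<longleftrightarrow>
     W \<noteq> {} \<and> preorder_on W R \<and> subalgebra P (frame_alg W R)"

definition frame_logic :: "'a set \<Rightarrow> 'a rel \<Rightarrow> 'a set set \<Rightarrow> fm set" where
  "frame_logic W R P = logic_of (restrict_alg (frame_alg W R) P)"

text \<open>\<^const>\<open>preorder_on\<close> includes \<open>R \<subseteq> W \<times> W\<close>, so in a general frame
  every zigzag path between points of \<open>W\<close> stays in \<open>W\<close>.\<close>

definition path_connected_frame :: "'a set \<Rightarrow> 'a rel \<Rightarrow> bool" where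
  "path_connected_frame W R \<longleftrightarrow> (\<forall>u\<in>W. \<forall>v\<in>W. (u, v) \<in> (R \<union> R\<inverse>)\<^sup>*)"


section \<open>The classes of logics that are compared\<close>

text \<open>HOL cannot quantify over types inside a formula. Where an algebra, frame or space of arbitrary
  provenance is asserted to exist, its underlying set is a subset of a type passed as a parameter,
  and equivalences between such properties are to be stated for all infinite parameter types. A
  finite type would be too small; in an infinite one every countable structure has a copy, and for
  algebras of larger types nothing is lost because the parameter is universally quantified.\<close>

definition connected_logic :: "'a itself \<Rightarrow> fm set \<Rightarrow> bool" where
  "connected_logic _ L \<longleftrightarrow>
     (\<exists>A :: 'a modal_alg. closure_algebra A \<and> connected_alg A \<and> L = logic_of A)"

definition logic_of_countable_path_connected_frame :: "'a itself \<Rightarrow> fm set \<Rightarrow> bool" where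
  "logic_of_countable_path_connected_frame _ L \<longleftrightarrow>
     (\<exists>(W :: 'a set) R P. general_S4_frame W R P \<and> countable W \<and> path_connected_frame W R \<and>
        L = frame_logic W R P)"

definition logic_of_countable_connected_space :: "'a itself \<Rightarrow> fm set \<Rightarrow> bool" where
  "logic_of_countable_connected_space _ L \<longleftrightarrow>
     (\<exists>(X :: 'a topology) P. general_space X P \<and> countable (topspace X) \<and> connected_space X \<and>
        L = space_logic X P)"

end

theory Submission
  imports Defs
begin

text \<open>
  All classes of logics are compared through connected closure algebras. A subalgebra of the closure
  algebra of a connected space is a connected closure algebra, and picking one refutation for each
  formula that is not valid produces a countable subalgebra with the same logic, which has a copy on
  every infinite type (\<open>connected_logic_transfer\<close>). A preorder is a topological space, with the
  upward closed sets as its open sets; it is a connected space when it is path-connected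
  (\<open>frame_imp_connected_space\<close>). Two steps remain.

  From connected algebras to path-connected frames (\<open>connected_logic_imp_frame\<close>). Represent the
  algebra by its ultrafilter frame. Connectedness of the algebra does not make this frame
  path-connected, so a frame with the same logic has to be built from parts of it. Every point sees a
  final point, that is, a point in a maximal cluster. If no point sees two unrelated final points, then
  connectedness forces all final points into one cluster, and the frame is path-connected. Otherwise,
  let \<open>w\<close> refute a formula under some valuation, and colour points by the truth values of its letters.
  The set of points above which exactly the colours of the final cluster above \<open>w\<close> occur is
  definable, and connectedness yields a point \<open>z\<close> seeing one final cluster with these colours and
  another final cluster that can be told apart from it (\<open>fork_over_color\<close>). Take the subframes
  generated by \<open>w\<close> and by \<open>z\<close>, glue the two final clusters with equal colours along the colours, and
  collapse the other final cluster above \<open>z\<close> to a point. This preserves the refutation and validates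
  the logic, since its admissible sets are sets of the product. Doing so for all formulas outside the
  logic and identifying all collapsed points gives one path-connected frame
  (\<open>glue_refutations\<close>). A downward Loewenheim--Skolem argument makes it countable
  (\<open>countable_frame_transfer\<close>).

  From countable path-connected frames to the real line (\<open>frame_imp_real_line\<close>). There need not be a
  continuous open map of the line onto the frame: Baire's theorem excludes it for an infinite
  ascending chain. Instead the line is labelled by points of the frame at infinitely many stages. Stage
  0 follows a path through the whole frame, with one unit interval for each point visited; in each
  later stage the middle third of every cell moves to a point above the label of the cell, and the
  division points keep their labels forever. Labels only move upwards along \<open>R\<close>, every stage is
  continuous for the topology of upward closed sets, and near each point of the line everything above
  its label is eventually realised. The set assigned to \<open>a\<close> consists of the points whose label lies in
  \<open>a\<close> at almost all stages with respect to a nonprincipal ultrafilter. The ultrafilter makes the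
  assignment a Boolean homomorphism, and continuity and realisation make it commute with closure
  (\<open>embedding\<close>).
\<close>

section \<open>Homomorphisms and logics\<close>

definition alg_hom :: "('a \<Rightarrow> 'b) \<Rightarrow> 'a modal_alg \<Rightarrow> 'b modal_alg \<Rightarrow> bool" where
  "alg_hom h A B \<longleftrightarrow>
     h ` carrier A \<subseteq> carrier B \<and> h (zero A) = zero B \<and> h (one A) = one B \<and>
     (\<forall>a\<in>carrier A. h (compl A a) = compl B (h a) \<and> h (dia A a) = dia B (h a)) \<and>
     (\<forall>a\<in>carrier A. \<forall>b\<in>carrier A. h (join A a b) = join B (h a) (h b) \<and>
        h (meet A a b) = meet B (h a) (h b))"

abbreviation closed_alg :: "'a modal_alg \<Rightarrow> bool" where
  "closed_alg A \<equiv> subalgebra (carrier A) A"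

lemma restrict_alg_simps [simp]:
  "carrier (restrict_alg A P) = P" "join (restrict_alg A P) = join A"
  "meet (restrict_alg A P) = meet A" "compl (restrict_alg A P) = compl A"
  "zero (restrict_alg A P) = zero A" "one (restrict_alg A P) = one A"
  "dia (restrict_alg A P) = dia A" "box (restrict_alg A P) = box A"
  by (auto simp: restrict_alg_def box_def fun_eq_iff)

lemma closed_alg_restrict: "subalgebra P A \<Longrightarrow> closed_alg (restrict_alg A P)"
  by (simp add: subalgebra_def)

lemma closed_alg_modal: "modal_algebra A \<Longrightarrow> closed_alg A"
  by (auto simp: modal_algebra_def boolean_alg_def subalgebra_def)

lemma eval_closed:
  assumes "closed_alg A" "\<And>n. v n \<in> carrier A"
  shows "eval_fm A v p \<in> carrier A"
  using assms by (induction p) (auto simp: subalgebra_def box_def)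

lemma eval_hom:
  assumes "alg_hom h A B" "closed_alg A" "\<And>n. v n \<in> carrier A"
  shows "h (eval_fm A v p) = eval_fm B (h \<circ> v) p"
proof (induction p)
qed (use assms eval_closed[OF assms(2,3)] in \<open>auto simp: alg_hom_def subalgebra_def box_def\<close>)

lemma eval_restrict [simp]: "eval_fm (restrict_alg A P) v p = eval_fm A v p"
  by (induction p) auto

text \<open>A refutation in \<open>B\<close> is mapped to a refutation in \<open>A\<close>, because \<open>h\<close> does not send the refuting
  value to \<open>1\<close>.\<close>
lemma logic_of_reflecting_hom:
  assumes "closed_alg B" "alg_hom h B A"
    and "\<And>b. b \<in> carrier B \<Longrightarrow> h b = one A \<Longrightarrow> b = one B"
  shows "logic_of A \<subseteq> logic_of B"
proof
  fix p assume p: "p \<in> logic_of A"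
  have "eval_fm B v p = one B" if v: "\<And>n. v n \<in> carrier B" for v
  proof (rule assms(3))
    show "eval_fm B v p \<in> carrier B" using assms(1) v by (rule eval_closed)
    have "h (eval_fm B v p) = eval_fm A (h \<circ> v) p" using assms(2,1) v by (rule eval_hom)
    moreover have "(h \<circ> v) n \<in> carrier A" for n
      using assms(2) v by (auto simp: alg_hom_def)
    ultimately show "h (eval_fm B v p) = one A"
      using p by (auto simp: logic_of_def valid_in_def)
  qed
  then show "p \<in> logic_of B" by (simp add: logic_of_def valid_in_def)
qed

text \<open>Every valuation in \<open>B\<close> lifts to one in \<open>A\<close>.\<close>
lemma logic_of_surj_hom:
  assumes "closed_alg A" "alg_hom h A B" "carrier B \<subseteq> h ` carrier A"
  shows "logic_of A \<subseteq> logic_of B"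
proof
  fix p assume p: "p \<in> logic_of A"
  have "eval_fm B v p = one B" if v: "\<And>n. v n \<in> carrier B" for v
  proof -
    have "\<exists>a\<in>carrier A. h a = v n" for n using subsetD[OF assms(3) v[of n]] by auto
    then obtain w where w: "\<And>n. w n \<in> carrier A" "\<And>n. h (w n) = v n" by metis
    have hw: "h \<circ> w = v" by (rule ext) (simp add: w)
    have "eval_fm B v p = h (eval_fm A w p)"
      unfolding hw[symmetric] by (rule eval_hom[symmetric, OF assms(2,1) w(1)])
    also have "\<dots> = one B"
      using p w assms(2) by (auto simp: logic_of_def valid_in_def alg_hom_def)
    finally show ?thesis .
  qed
  then show "p \<in> logic_of B" by (simp add: logic_of_def valid_in_def)
qed

lemma logic_of_iso:
  assumes "closed_alg A" "alg_hom h A B" "carrier B \<subseteq> h ` carrier A"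
    and "\<And>a. a \<in> carrier A \<Longrightarrow> h a = one B \<Longrightarrow> a = one A"
  shows "logic_of B = logic_of A"
proof
  show "logic_of A \<subseteq> logic_of B" using logic_of_surj_hom assms by blast
  show "logic_of B \<subseteq> logic_of A"
    using assms(1,2,4) by (rule logic_of_reflecting_hom)
qed

section \<open>Countable subalgebras\<close>

primrec fm_code :: "fm \<Rightarrow> nat" where
  "fm_code (Atom n) = prod_encode (0, n)"
| "fm_code Top = prod_encode (1, 0)"
| "fm_code Bot = prod_encode (2, 0)"
| "fm_code (Neg p) = prod_encode (3, fm_code p)"
| "fm_code (Con p q) = prod_encode (4, prod_encode (fm_code p, fm_code q))"
| "fm_code (Dis p q) = prod_encode (5, prod_encode (fm_code p, fm_code q))"
| "fm_code (Imp p q) = prod_encode (6, prod_encode (fm_code p, fm_code q))"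
| "fm_code (Dia p) = prod_encode (7, fm_code p)"
| "fm_code (Box p) = prod_encode (8, fm_code p)"

lemma fm_code_inject: "fm_code p = fm_code q \<Longrightarrow> p = q"
  by (induction p arbitrary: q; case_tac q; simp)

instance fm :: countable
  by (rule countable_classI[of fm_code]) (rule fm_code_inject)

text \<open>The common core of the two Loewenheim--Skolem arguments below, for algebras and for frames.\<close>
lemma countable_closure:
  fixes F :: "'a \<Rightarrow> 'a \<Rightarrow> 'a set"
  assumes "countable S" "S \<subseteq> K" "\<And>x y. x \<in> K \<Longrightarrow> y \<in> K \<Longrightarrow> F x y \<subseteq> K"
    and "\<And>x y. x \<in> K \<Longrightarrow> y \<in> K \<Longrightarrow> countable (F x y)"
  obtains C where "countable C" "S \<subseteq> C" "C \<subseteq> K" "\<forall>x\<in>C. \<forall>y\<in>C. F x y \<subseteq> C"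
proof -
  define st where "st T = T \<union> (\<Union>x\<in>T. \<Union>y\<in>T. F x y)" for T
  define D where "D n = (st ^^ n) S" for n
  have D_Suc: "D (Suc n) = st (D n)" and D0: "D 0 = S" for n by (auto simp: D_def)
  have D: "countable (D n) \<and> D n \<subseteq> K" for n
  proof (induction n)
    case (Suc n)
    have "countable (st (D n))" unfolding st_def
      using Suc assms(4) by (intro countable_Un countable_UN) auto
    moreover have "st (D n) \<subseteq> K" unfolding st_def using Suc assms(3) by blast
    ultimately show ?case by (simp add: D_Suc)
  qed (use assms in \<open>auto simp: D0\<close>)
  have mono: "m \<le> n \<Longrightarrow> D m \<subseteq> D n" for m n
    by (rule lift_Suc_mono_le[of D]) (auto simp: D_Suc st_def)
  show ?thesis
  proof (rule that[of "\<Union>n. D n"])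
    show "\<forall>x\<in>\<Union>n. D n. \<forall>y\<in>\<Union>n. D n. F x y \<subseteq> (\<Union>n. D n)"
    proof (intro ballI)
      fix x y assume "x \<in> (\<Union>n. D n)" "y \<in> (\<Union>n. D n)"
      then obtain m n where "x \<in> D m" "y \<in> D n" by blast
      then have "x \<in> D (max m n)" "y \<in> D (max m n)"
        using mono by (meson max.cobounded1 max.cobounded2 subsetD)+
      then have "F x y \<subseteq> D (Suc (max m n))" by (auto simp: D_Suc st_def)
      then show "F x y \<subseteq> (\<Union>n. D n)" by blast
    qed
  qed (use D D0 in \<open>auto\<close>)
qed

text \<open>Generate the subalgebra by one refuting valuation for each of the countably many formulas that are
  not valid.\<close>
lemma countable_subalgebra:
  assumes A: "closed_alg A"
  obtains C where "subalgebra C A" "countable C" "logic_of (restrict_alg A C) = logic_of A"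
proof -
  have "\<forall>p. p \<notin> logic_of A \<longrightarrow> (\<exists>v. (\<forall>n. v n \<in> carrier A) \<and> eval_fm A v p \<noteq> one A)"
    by (auto simp: logic_of_def valid_in_def)
  then obtain V where V: "\<And>p n. p \<notin> logic_of A \<Longrightarrow> V p n \<in> carrier A"
    "\<And>p. p \<notin> logic_of A \<Longrightarrow> eval_fm A (V p) p \<noteq> one A" by metis
  define S where "S = {zero A, one A} \<union> (\<Union>p\<in>-logic_of A. range (V p))"
  have S: "countable S" "S \<subseteq> carrier A"
    using V(1) A by (auto simp: S_def subalgebra_def)
  obtain C where C: "countable C" "S \<subseteq> C" "C \<subseteq> carrier A"
    "\<forall>x\<in>C. \<forall>y\<in>C. {compl A x, dia A x, join A x y, meet A x y} \<subseteq> C"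
    by (rule countable_closure[OF S, of "\<lambda>x y. {compl A x, dia A x, join A x y, meet A x y}"])
      (use A in \<open>auto simp: subalgebra_def\<close>)
  have sub: "subalgebra C A" using C unfolding subalgebra_def S_def by auto
  have "p \<in> logic_of A" if p: "p \<in> logic_of (restrict_alg A C)" for p
  proof (rule ccontr)
    assume n: "p \<notin> logic_of A"
    then have "V p k \<in> C" for k using C(2) by (auto simp: S_def)
    then show False using p V(2)[OF n] by (auto simp: logic_of_def valid_in_def)
  qed
  moreover have "p \<in> logic_of (restrict_alg A C)" if p: "p \<in> logic_of A" for p
    using p C(3) by (auto simp: logic_of_def valid_in_def)
  ultimately show ?thesis using that sub C(1) by blast
qed

lemma infinite_type_embedding:
  assumes "countable (C :: 'x set)"
  obtains f :: "'x \<Rightarrow> 'a::infinite" where "inj_on f C"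
proof -
  obtain g :: "nat \<Rightarrow> 'a" where g: "inj g"
    using infinite_countable_subset[OF infinite_UNIV] by blast
  have "inj_on (g \<circ> to_nat_on C) C"
    using g assms by (intro comp_inj_on inj_on_to_nat_on) (auto intro: inj_on_subset)
  then show ?thesis using that by blast
qed

lemma boolean_algD:
  assumes "boolean_alg A"
  shows "zero A \<in> carrier A" "one A \<in> carrier A" "zero A \<noteq> one A"
    "\<And>a. a \<in> carrier A \<Longrightarrow> compl A a \<in> carrier A"
    "\<And>a b. a \<in> carrier A \<Longrightarrow> b \<in> carrier A \<Longrightarrow> join A a b \<in> carrier A"
    "\<And>a b. a \<in> carrier A \<Longrightarrow> b \<in> carrier A \<Longrightarrow> meet A a b \<in> carrier A"
    "\<And>a b c. a \<in> carrier A \<Longrightarrow> b \<in> carrier A \<Longrightarrow> c \<in> carrier A \<Longrightarrow>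
       join A (join A a b) c = join A a (join A b c)"
    "\<And>a b c. a \<in> carrier A \<Longrightarrow> b \<in> carrier A \<Longrightarrow> c \<in> carrier A \<Longrightarrow>
       meet A (meet A a b) c = meet A a (meet A b c)"
    "\<And>a b. a \<in> carrier A \<Longrightarrow> b \<in> carrier A \<Longrightarrow> join A a b = join A b a"
    "\<And>a b. a \<in> carrier A \<Longrightarrow> b \<in> carrier A \<Longrightarrow> meet A a b = meet A b a"
    "\<And>a b c. a \<in> carrier A \<Longrightarrow> b \<in> carrier A \<Longrightarrow> c \<in> carrier A \<Longrightarrow>
       meet A a (join A b c) = join A (meet A a b) (meet A a c)"
    "\<And>a b c. a \<in> carrier A \<Longrightarrow> b \<in> carrier A \<Longrightarrow> c \<in> carrier A \<Longrightarrow>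
       join A a (meet A b c) = meet A (join A a b) (join A a c)"
    "\<And>a. a \<in> carrier A \<Longrightarrow> join A a (zero A) = a"
    "\<And>a. a \<in> carrier A \<Longrightarrow> meet A a (one A) = a"
    "\<And>a. a \<in> carrier A \<Longrightarrow> join A a (compl A a) = one A"
    "\<And>a. a \<in> carrier A \<Longrightarrow> meet A a (compl A a) = zero A"
proof -
  note h0 = assms[unfolded boolean_alg_def, THEN conjunct1, rule_format]
  note h1 = assms[unfolded boolean_alg_def, THEN conjunct2, THEN conjunct1, rule_format]
  note h2 = assms[unfolded boolean_alg_def, THEN conjunct2, THEN conjunct2, THEN conjunct1, rule_format]
  note h3 = assms[unfolded boolean_alg_def, THEN conjunct2, THEN conjunct2, THEN conjunct2, THEN conjunct1, rule_format]
  note h4 = assms[unfolded boolean_alg_def, THEN conjunct2, THEN conjunct2, THEN conjunct2, THEN conjunct2, THEN conjunct1, rule_format]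
  note h5 = assms[unfolded boolean_alg_def, THEN conjunct2, THEN conjunct2, THEN conjunct2, THEN conjunct2, THEN conjunct2, THEN conjunct1, rule_format]
  note h6 = assms[unfolded boolean_alg_def, THEN conjunct2, THEN conjunct2, THEN conjunct2, THEN conjunct2, THEN conjunct2, THEN conjunct2, THEN conjunct1, rule_format]
  note h7 = assms[unfolded boolean_alg_def, THEN conjunct2, THEN conjunct2, THEN conjunct2, THEN conjunct2, THEN conjunct2, THEN conjunct2, THEN conjunct2, THEN conjunct1, rule_format]
  note h8 = assms[unfolded boolean_alg_def, THEN conjunct2, THEN conjunct2, THEN conjunct2, THEN conjunct2, THEN conjunct2, THEN conjunct2, THEN conjunct2, THEN conjunct2, THEN conjunct1, rule_format]
  note h9 = assms[unfolded boolean_alg_def, THEN conjunct2, THEN conjunct2, THEN conjunct2, THEN conjunct2, THEN conjunct2, THEN conjunct2, THEN conjunct2, THEN conjunct2, THEN conjunct2, rule_format]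
  show "zero A \<in> carrier A" by (rule h0)
  show "one A \<in> carrier A" by (rule h1)
  show "zero A \<noteq> one A" by (rule h2)
  show "\<And>a. a \<in> carrier A \<Longrightarrow> compl A a \<in> carrier A" by (rule h3)
  show "\<And>a b. a \<in> carrier A \<Longrightarrow> b \<in> carrier A \<Longrightarrow> join A a b \<in> carrier A" by (rule h4[THEN conjunct1])
  show "\<And>a b. a \<in> carrier A \<Longrightarrow> b \<in> carrier A \<Longrightarrow> meet A a b \<in> carrier A" by (rule h4[THEN conjunct2])
  show "\<And>a b c. a \<in> carrier A \<Longrightarrow> b \<in> carrier A \<Longrightarrow> c \<in> carrier A \<Longrightarrow>
       join A (join A a b) c = join A a (join A b c)" by (rule h5[THEN conjunct1])
  show "\<And>a b c. a \<in> carrier A \<Longrightarrow> b \<in> carrier A \<Longrightarrow> c \<in> carrier A \<Longrightarrow>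
       meet A (meet A a b) c = meet A a (meet A b c)" by (rule h5[THEN conjunct2])
  show "\<And>a b. a \<in> carrier A \<Longrightarrow> b \<in> carrier A \<Longrightarrow> join A a b = join A b a" by (rule h6[THEN conjunct1])
  show "\<And>a b. a \<in> carrier A \<Longrightarrow> b \<in> carrier A \<Longrightarrow> meet A a b = meet A b a" by (rule h6[THEN conjunct2])
  show "\<And>a b c. a \<in> carrier A \<Longrightarrow> b \<in> carrier A \<Longrightarrow> c \<in> carrier A \<Longrightarrow>
       meet A a (join A b c) = join A (meet A a b) (meet A a c)" by (rule h7[THEN conjunct1])
  show "\<And>a b c. a \<in> carrier A \<Longrightarrow> b \<in> carrier A \<Longrightarrow> c \<in> carrier A \<Longrightarrow>
       join A a (meet A b c) = meet A (join A a b) (join A a c)" by (rule h7[THEN conjunct2])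
  show "\<And>a. a \<in> carrier A \<Longrightarrow> join A a (zero A) = a" by (rule h8[THEN conjunct1])
  show "\<And>a. a \<in> carrier A \<Longrightarrow> meet A a (one A) = a" by (rule h8[THEN conjunct2])
  show "\<And>a. a \<in> carrier A \<Longrightarrow> join A a (compl A a) = one A" by (rule h9[THEN conjunct1])
  show "\<And>a. a \<in> carrier A \<Longrightarrow> meet A a (compl A a) = zero A" by (rule h9[THEN conjunct2])
qed

lemma closure_algebra_subalgebra:
  assumes "closure_algebra A" "subalgebra P A"
  shows "closure_algebra (restrict_alg A P)"
proof -
  have P: "a \<in> carrier A" if "a \<in> P" for a using that assms(2) by (auto simp: subalgebra_def)
  have A: "boolean_alg A" using assms(1) by (simp add: closure_algebra_def modal_algebra_def)
  have "boolean_alg (restrict_alg A P)"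
    unfolding boolean_alg_def restrict_alg_simps
  proof (intro conjI ballI)
  qed (use assms(2) boolean_algD(3)[OF A] in \<open>simp_all add: subalgebra_def\<close>;
       rule boolean_algD[OF A]; rule P; assumption)+
  moreover have "leq (restrict_alg A P) = leq A" by (simp add: leq_def fun_eq_iff)
  ultimately show ?thesis
    using assms P by (simp add: closure_algebra_def modal_algebra_def subalgebra_def)
qed

lemma connected_alg_subalgebra:
  "connected_alg A \<Longrightarrow> subalgebra P A \<Longrightarrow> connected_alg (restrict_alg A P)"
  by (auto simp: connected_alg_def subalgebra_def)

text \<open>Being connected is inherited by subalgebras, so a countable subalgebra with the same logic can be
  copied to any infinite type.\<close>
lemma connected_logic_transfer:
  assumes "closure_algebra (A :: 'x modal_alg)" "connected_alg A"
  shows "connected_logic TYPE('a::infinite) (logic_of A)"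
proof -
  have A: "closed_alg A" using assms by (simp add: closure_algebra_def closed_alg_modal)
  obtain C where C: "subalgebra C A" "countable C" "logic_of (restrict_alg A C) = logic_of A"
    using countable_subalgebra[OF A] .
  define B where "B = restrict_alg A C"
  have B: "closure_algebra B" "connected_alg B" "closed_alg B" "countable (carrier B)"
    "logic_of B = logic_of A"
    using C closure_algebra_subalgebra connected_alg_subalgebra assms closed_alg_restrict
    by (auto simp: B_def)
  obtain f :: "'x \<Rightarrow> 'a" where f: "inj_on f (carrier B)" using infinite_type_embedding[OF B(4)] .
  define g where "g = inv_into (carrier B) f"
  have gf: "g (f x) = x" if "x \<in> carrier B" for x using f that by (simp add: g_def)
  define D where "D = \<lparr>carrier = f ` carrier B, join = (\<lambda>x y. f (join B (g x) (g y))),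
     meet = (\<lambda>x y. f (meet B (g x) (g y))), compl = (\<lambda>x. f (compl B (g x))),
     zero = f (zero B), one = f (one B), dia = (\<lambda>x. f (dia B (g x)))\<rparr>"
  have Ds: "carrier D = f ` carrier B" "join D = (\<lambda>x y. f (join B (g x) (g y)))"
    "meet D = (\<lambda>x y. f (meet B (g x) (g y)))" "compl D = (\<lambda>x. f (compl B (g x)))"
    "zero D = f (zero B)" "one D = f (one B)" "dia D = (\<lambda>x. f (dia B (g x)))"
    by (simp_all add: D_def)
  have inj: "f x = f y \<longleftrightarrow> x = y" if "x \<in> carrier B" "y \<in> carrier B" for x y
    using f that by (simp add: inj_on_eq_iff)
  have cl: "zero B \<in> carrier B" "one B \<in> carrier B"
    "\<And>a. a \<in> carrier B \<Longrightarrow> compl B a \<in> carrier B" "\<And>a. a \<in> carrier B \<Longrightarrow> dia B a \<in> carrier B"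
    "\<And>a b. a \<in> carrier B \<Longrightarrow> b \<in> carrier B \<Longrightarrow> join B a b \<in> carrier B"
    "\<And>a b. a \<in> carrier B \<Longrightarrow> b \<in> carrier B \<Longrightarrow> meet B a b \<in> carrier B"
    using B(3) by (auto simp: subalgebra_def)
  have hom: "alg_hom f B D"
    by (auto simp: alg_hom_def Ds gf)
  have bB: "boolean_alg B" using B(1) by (simp add: closure_algebra_def modal_algebra_def)
  have "boolean_alg D"
    unfolding boolean_alg_def Ds
    by (intro conjI ballI)
      (auto simp: gf cl inj boolean_algD(3,13-16)[OF bB] intro: boolean_algD(7-12)[OF bB])
  moreover have "modal_algebra B" using B(1) by (simp add: closure_algebra_def)
  ultimately have "modal_algebra D"
    unfolding modal_algebra_def Ds
    by (simp add: gf cl inj)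
  then have "closure_algebra D"
    using B(1) unfolding closure_algebra_def leq_def Ds
    by (simp add: gf cl inj)
  moreover have "connected_alg D"
    using B(2) unfolding connected_alg_def box_def Ds by (simp add: gf cl inj)
  moreover have "logic_of D = logic_of B"
  proof (rule logic_of_iso[OF B(3) hom])
    show "a = one B" if "a \<in> carrier B" "f a = one D" for a
      using that by (simp add: D_def inj cl)
  qed (simp add: Ds)
  ultimately show ?thesis unfolding connected_logic_def using B(5) by metis
qed

section \<open>Ultrafilters of a Boolean algebra\<close>

definition ultrafilters :: "'a modal_alg \<Rightarrow> 'a set set" where
  "ultrafilters A = {u. u \<subseteq> carrier A \<and> one A \<in> u \<and> zero A \<notin> u \<and>
     (\<forall>a\<in>carrier A. compl A a \<in> u \<longleftrightarrow> a \<notin> u) \<and>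
     (\<forall>a\<in>carrier A. \<forall>b\<in>carrier A. (meet A a b \<in> u \<longleftrightarrow> a \<in> u \<and> b \<in> u) \<and>
        (join A a b \<in> u \<longleftrightarrow> a \<in> u \<or> b \<in> u))}"

lemma ultrafiltersD:
  assumes "u \<in> ultrafilters A"
  shows "one A \<in> u" "zero A \<notin> u" "a \<in> u \<Longrightarrow> a \<in> carrier A"
    "a \<in> carrier A \<Longrightarrow> compl A a \<in> u \<longleftrightarrow> a \<notin> u"
    "a \<in> carrier A \<Longrightarrow> b \<in> carrier A \<Longrightarrow> meet A a b \<in> u \<longleftrightarrow> a \<in> u \<and> b \<in> u"
    "a \<in> carrier A \<Longrightarrow> b \<in> carrier A \<Longrightarrow> join A a b \<in> u \<longleftrightarrow> a \<in> u \<or> b \<in> u"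
  using assms by (auto simp: ultrafilters_def)

locale carrier_boolean_algebra =
  fixes A :: "'a modal_alg"
  assumes boolean_alg: "boolean_alg A"
begin

abbreviation C where "C \<equiv> carrier A"
abbreviation J (infixl "\<squnion>" 65) where "a \<squnion> b \<equiv> join A a b"
abbreviation M (infixl "\<sqinter>" 70) where "a \<sqinter> b \<equiv> meet A a b"
abbreviation N ("\<ominus> _" [81] 80) where "\<ominus> a \<equiv> compl A a"
abbreviation Z ("\<zero>") where "\<zero> \<equiv> zero A"
abbreviation E ("\<one>") where "\<one> \<equiv> one A"

lemmas closed [simp, intro] = boolean_algD(1,2,4-6)[OF boolean_alg]
lemmas zero_neq_one = boolean_algD(3)[OF boolean_alg]
lemmas J_assoc = boolean_algD(7)[OF boolean_alg]
lemmas M_assoc = boolean_algD(8)[OF boolean_alg]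
lemmas J_comm = boolean_algD(9)[OF boolean_alg]
lemmas M_comm = boolean_algD(10)[OF boolean_alg]
lemmas M_J = boolean_algD(11)[OF boolean_alg]
lemmas J_M = boolean_algD(12)[OF boolean_alg]
lemmas units [simp] = boolean_algD(13-16)[OF boolean_alg]

lemma M_zero [simp]: "a \<in> C \<Longrightarrow> a \<sqinter> \<zero> = \<zero>"
  using M_J[of a \<zero> "\<ominus> a"] J_comm[of \<zero> "\<ominus> a"] J_comm[of "a \<sqinter> \<zero>" \<zero>] by simp

lemma zero_M [simp]: "a \<in> C \<Longrightarrow> \<zero> \<sqinter> a = \<zero>"
  using M_comm[of a \<zero>] by simp

lemma M_idem [simp]: "a \<in> C \<Longrightarrow> a \<sqinter> a = a"
  using M_J[of a a "\<ominus> a"] by simp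

lemma J_idem [simp]: "a \<in> C \<Longrightarrow> a \<squnion> a = a"
  using J_M[of a a "\<ominus> a"] by simp

lemma one_M [simp]: "a \<in> C \<Longrightarrow> \<one> \<sqinter> a = a"
  using M_comm[of a \<one>] by simp

lemma J_eq_zero: "a \<in> C \<Longrightarrow> b \<in> C \<Longrightarrow> a \<squnion> b = \<zero> \<Longrightarrow> a = \<zero>"
  using J_assoc[of a a b] by simp

lemma M_zero_extend:
  assumes "m \<in> C" "n \<in> C" "a \<in> C" "m \<sqinter> a = \<zero>"
  shows "n \<sqinter> m \<sqinter> a = \<zero>" "m \<sqinter> n \<sqinter> a = \<zero>" "m \<sqinter> (a \<sqinter> n) = \<zero>"
  using assms M_assoc[of n m a] M_assoc[of m a n] M_comm[of m n] by simp_all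

text \<open>A maximal set that is closed under meets and omits \<open>0\<close> is automatically upward closed: an element
  outside it is disjoint from one of its members. Zorn's lemma can therefore be applied to
  meet-closed sets, without generating filters.\<close>
lemma ultrafilter_exists:
  assumes F: "F \<subseteq> C" "\<zero> \<notin> F" "\<And>a b. a \<in> F \<Longrightarrow> b \<in> F \<Longrightarrow> a \<sqinter> b \<in> F"
  obtains u where "u \<in> ultrafilters A" "F \<subseteq> u"
proof -
  define S where "S = {U. insert \<one> F \<subseteq> U \<and> U \<subseteq> C \<and> \<zero> \<notin> U \<and> (\<forall>a\<in>U. \<forall>b\<in>U. a \<sqinter> b \<in> U)}"
  have one_F: "insert \<one> F \<in> S"
    using F zero_neq_one by (auto simp: S_def subset_iff)
  have "\<Union>K \<in> S" if "K \<noteq> {}" and ch: "subset.chain S K" for K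
  proof -
    have KS: "K \<subseteq> S" using ch by (simp add: subset.chain_def)
    have "a \<sqinter> b \<in> \<Union>K" if ab: "a \<in> \<Union>K" "b \<in> \<Union>K" for a b
    proof -
      obtain U V where UV: "U \<in> K" "V \<in> K" "a \<in> U" "b \<in> V" using ab by blast
      then have "U \<subseteq> V \<or> V \<subseteq> U" using ch by (auto simp: subset.chain_def)
      moreover have "x \<sqinter> y \<in> W" if "W \<in> K" "x \<in> W" "y \<in> W" for x y W
        using that KS by (auto simp: S_def)
      ultimately show ?thesis using UV by blast
    qed
    moreover have "insert \<one> F \<subseteq> \<Union>K" "\<Union>K \<subseteq> C" "\<zero> \<notin> \<Union>K"
      using \<open>K \<noteq> {}\<close> KS unfolding S_def by blast+
    ultimately show ?thesis by (auto simp: S_def)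
  qed
  then obtain U where US: "U \<in> S" and max: "\<And>V. V \<in> S \<Longrightarrow> U \<subseteq> V \<Longrightarrow> V = U"
    using subset_Zorn_nonempty[of S] one_F by blast
  have U: "\<one> \<in> U" "F \<subseteq> U" "\<And>a. a \<in> U \<Longrightarrow> a \<in> C" "\<zero> \<notin> U" "\<And>a b. a \<in> U \<Longrightarrow> b \<in> U \<Longrightarrow> a \<sqinter> b \<in> U"
    using US by (auto simp: S_def)
  have zero: "\<exists>m\<in>U. m \<sqinter> a = \<zero>" if a: "a \<in> C" "a \<notin> U" for a
  proof (rule ccontr)
    assume n: "\<not> ?thesis"
    define V where "V = U \<union> (\<lambda>m. m \<sqinter> a) ` U"
    have 1: "m \<sqinter> (n \<sqinter> a) = m \<sqinter> n \<sqinter> a" "n \<sqinter> a \<sqinter> m = n \<sqinter> m \<sqinter> a"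
      "m \<sqinter> a \<sqinter> (n \<sqinter> a) = m \<sqinter> n \<sqinter> a" if "m \<in> U" "n \<in> U" for m n
    proof -
      have mn: "m \<in> C" "n \<in> C" using U(3) that by auto
      show "m \<sqinter> (n \<sqinter> a) = m \<sqinter> n \<sqinter> a" using mn a(1) by (simp add: M_assoc)
      show "n \<sqinter> a \<sqinter> m = n \<sqinter> m \<sqinter> a" using mn a(1) by (simp add: M_assoc M_comm[of a m])
      have "a \<sqinter> (n \<sqinter> a) = n \<sqinter> a" using mn a(1) by (simp add: M_assoc M_comm[of a "n \<sqinter> a"])
      then show "m \<sqinter> a \<sqinter> (n \<sqinter> a) = m \<sqinter> n \<sqinter> a" using mn a(1) by (simp add: M_assoc)
    qed
    have "x \<sqinter> y \<in> V" if "x \<in> V" "y \<in> V" for x y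
      using that 1 U(5) by (auto simp: V_def)
    moreover have "V \<subseteq> C" "\<zero> \<notin> V" "insert \<one> F \<subseteq> V" using n U a by (auto simp: V_def)
    ultimately have "V \<in> S" by (auto simp: S_def)
    then have "V = U" using max by (auto simp: V_def)
    moreover have "a \<in> V" using U(1) a by (force simp: V_def)
    ultimately show False using a by simp
  qed
  have both: "a \<in> U \<or> b \<in> U" if ab: "a \<in> C" "b \<in> C" "a \<squnion> b \<in> U" for a b
  proof (rule ccontr)
    assume "\<not> ?thesis"
    then obtain m n where mn: "m \<in> U" "m \<sqinter> a = \<zero>" "n \<in> U" "n \<sqinter> b = \<zero>"
      using zero[OF ab(1)] zero[OF ab(2)] by auto
    then have "m \<sqinter> n \<sqinter> (a \<squnion> b) = \<zero>"
      using U(3) ab M_zero_extend(1)[of n m b] M_zero_extend(2)[of m n a] by (simp add: M_J)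
    then show False using U(4) U(5)[OF U(5)[OF mn(1,3)] ab(3)] by simp
  qed
  have up: "a \<in> U" if ab: "a \<in> C" "b \<in> C" "a \<sqinter> b \<in> U" for a b
  proof (rule ccontr)
    assume "a \<notin> U"
    then obtain m where m: "m \<in> U" "m \<sqinter> a = \<zero>" using zero[OF ab(1)] \<open>a \<notin> U\<close> by auto
    then have "m \<sqinter> (a \<sqinter> b) = \<zero>" using M_zero_extend(3)[of m b a] U(3) m ab by simp
    then show False using U(4) U(5)[OF m(1) ab(3)] by simp
  qed
  have upJ: "a \<squnion> b \<in> U" if ab: "a \<in> U" "b \<in> C" for a b
  proof (rule ccontr)
    assume "a \<squnion> b \<notin> U"
    then obtain m where m: "m \<in> U" "m \<sqinter> (a \<squnion> b) = \<zero>"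
      using zero[of "a \<squnion> b"] U(3)[OF ab(1)] ab(2) \<open>a \<squnion> b \<notin> U\<close> by auto
    then have "m \<sqinter> a = \<zero>" using J_eq_zero[of "m \<sqinter> a" "m \<sqinter> b"] U(3) ab by (simp add: M_J)
    then show False using U(4) U(5)[OF m(1) ab(1)] by simp
  qed
  have "a \<squnion> b \<in> U \<longleftrightarrow> a \<in> U \<or> b \<in> U" if "a \<in> C" "b \<in> C" for a b
    using both[OF that] upJ[of a b] upJ[of b a] that J_comm[OF that(2,1)] by auto
  moreover have "a \<sqinter> b \<in> U \<longleftrightarrow> a \<in> U \<and> b \<in> U" if "a \<in> C" "b \<in> C" for a b
    using up[OF that] up[OF that(2,1)] U(5)[of a b] M_comm[OF that(2,1)] by auto
  moreover have "\<ominus> a \<in> U \<longleftrightarrow> a \<notin> U" if "a \<in> C" for a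
    using both[of a "\<ominus> a"] U(1,4) U(5)[of a "\<ominus> a"] that by auto
  ultimately have "U \<in> ultrafilters A" using U(1,3,4) by (auto simp: ultrafilters_def)
  then show ?thesis using that U(2) by blast
qed

text \<open>Boolean identities become propositional reasoning about membership in an ultrafilter, which
  replaces calculation from the axioms.\<close>
lemma eq_by_ultrafilters:
  assumes ab: "a \<in> C" "b \<in> C" and eq: "\<And>u. u \<in> ultrafilters A \<Longrightarrow> a \<in> u \<longleftrightarrow> b \<in> u"
  shows "a = b"
proof -
  have "a \<sqinter> \<ominus> b = \<zero>" if ab: "a \<in> C" "b \<in> C" and eq: "\<And>u. u \<in> ultrafilters A \<Longrightarrow> a \<in> u \<longleftrightarrow> b \<in> u" for a b
  proof (rule ccontr)
    assume "a \<sqinter> \<ominus> b \<noteq> \<zero>"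
    then obtain u where "u \<in> ultrafilters A" "{a \<sqinter> \<ominus> b} \<subseteq> u"
      by (rule_tac ultrafilter_exists[of "{a \<sqinter> \<ominus> b}"]) (simp_all add: ab)
    then show False using eq[of u] ab ultrafiltersD(4,5)[of u A] by auto
  qed
  from this[OF ab eq] this[OF ab(2,1)] eq have "a \<sqinter> \<ominus> b = \<zero>" "b \<sqinter> \<ominus> a = \<zero>" by auto
  then have "a = a \<sqinter> b" "b = b \<sqinter> a"
    using M_J[of a b "\<ominus> b"] M_J[of b a "\<ominus> a"] ab by auto
  then show ?thesis using M_comm ab by metis
qed

end

section \<open>Algebras of frames and spaces\<close>

lemma frame_alg_simps [simp]:
  "carrier (frame_alg W R) = Pow W" "join (frame_alg W R) = (\<union>)" "meet (frame_alg W R) = (\<inter>)"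
  "compl (frame_alg W R) = (-) W" "zero (frame_alg W R) = {}" "one (frame_alg W R) = W"
  "dia (frame_alg W R) = (``) (R\<inverse>)" "box (frame_alg W R) a = W - R\<inverse> `` (W - a)"
  by (auto simp: frame_alg_def powerset_alg_def box_def fun_eq_iff)

lemma space_alg_simps [simp]:
  "carrier (space_alg X) = Pow (topspace X)" "join (space_alg X) = (\<union>)"
  "meet (space_alg X) = (\<inter>)" "compl (space_alg X) = (-) (topspace X)" "zero (space_alg X) = {}"
  "one (space_alg X) = topspace X" "dia (space_alg X) = (closure_of) X"
  "box (space_alg X) a = topspace X - X closure_of (topspace X - a)"
  by (auto simp: space_alg_def powerset_alg_def box_def fun_eq_iff)

lemma boolean_alg_set_alg:
  assumes "carrier A = Pow W" "join A = (\<union>)" "meet A = (\<inter>)" "compl A = (-) W" "zero A = {}"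
    "one A = W" "W \<noteq> {}"
  shows "boolean_alg A"
  unfolding boolean_alg_def assms(1-6) using assms(7) by (intro conjI ballI) auto

lemma closure_algebra_space:
  assumes "topspace X \<noteq> {}"
  shows "closure_algebra (space_alg X)"
proof -
  have "boolean_alg (space_alg X)" using assms by (intro boolean_alg_set_alg) auto
  then show ?thesis
    by (auto simp: closure_algebra_def modal_algebra_def leq_def closure_of_subset_topspace
        closure_of_subset Un_absorb1)
qed

lemma connected_alg_space:
  assumes "connected_space X"
  shows "connected_alg (space_alg X)"
proof -
  have "a = {} \<or> a = topspace X"
    if a: "a \<subseteq> topspace X" "topspace X - X closure_of (topspace X - a) = a" "X closure_of a = a" for a
  proof -
    have "closedin X a" using closedin_closure_of[of X a] a(3) by simp
    moreover have "openin X (topspace X - X closure_of (topspace X - a))"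
      by (rule openin_diff) auto
    ultimately show ?thesis using assms a(2) by (auto simp: connected_space_clopen_in)
  qed
  then show ?thesis by (auto simp: connected_alg_def)
qed

lemma connected_logic_of_space:
  assumes "general_space X P" "connected_space X"
  shows "connected_logic TYPE('a::infinite) (space_logic X P)"
  unfolding space_logic_def
proof (rule connected_logic_transfer)
  have "subalgebra P (space_alg X)" "topspace X \<noteq> {}"
    using assms(1) by (simp_all add: general_space_def)
  then show "closure_algebra (restrict_alg (space_alg X) P)"
    "connected_alg (restrict_alg (space_alg X) P)"
    by (simp_all add: closure_algebra_subalgebra closure_algebra_space
      connected_alg_subalgebra connected_alg_space assms(2))
qed

section \<open>The ultrafilter frame\<close>

abbreviation frame_sub :: "'a set \<Rightarrow> 'a rel \<Rightarrow> 'a set set \<Rightarrow> 'a set modal_alg" where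
  "frame_sub W R P \<equiv> restrict_alg (frame_alg W R) P"

text \<open>In a preorder these are the points whose cluster is maximal; the cluster is then \<open>R `` {d}\<close>.\<close>
definition final_in :: "'a rel \<Rightarrow> 'a \<Rightarrow> bool" where
  "final_in R d \<longleftrightarrow> (\<forall>y. (d, y) \<in> R \<longrightarrow> (y, d) \<in> R)"

text \<open>The relation is the largest one inducing the same closure operator on \<open>P\<close>.\<close>
definition tight :: "'a set \<Rightarrow> 'a rel \<Rightarrow> 'a set set \<Rightarrow> bool" where
  "tight W R P \<longleftrightarrow> (\<forall>x\<in>W. \<forall>y\<in>W. (\<forall>a\<in>P. y \<in> a \<longrightarrow> x \<in> R\<inverse> `` a) \<longrightarrow> (x, y) \<in> R)"

text \<open>The Jonsson--Tarski representation: \<open>u\<close> sees \<open>v\<close> if \<open>\<diamond>a \<in> u\<close> for all \<open>a \<in> v\<close>. Apart from the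
  representation itself, the construction of the glued frame needs that the relation is tight and that
  final points lie above every point; the latter is a compactness property of this particular frame.\<close>
lemma ultrafilter_frame:
  fixes A :: "'a modal_alg"
  assumes A: "closure_algebra A" "connected_alg A"
  obtains W :: "'a set set" and R P where "general_S4_frame W R P" "frame_logic W R P = logic_of A"
    "connected_alg (frame_sub W R P)" "tight W R P"
    "\<forall>x\<in>W. \<exists>d. (x, d) \<in> R \<and> final_in R d"
proof -
  have bA: "boolean_alg A" and mA: "modal_algebra A"
    using A by (simp_all add: closure_algebra_def modal_algebra_def)
  interpret carrier_boolean_algebra A using bA by unfold_locales
  have dia_C [simp]: "dia A a \<in> C" if "a \<in> C" for a using mA that by (simp add: modal_algebra_def)
  have dia_J: "dia A (a \<squnion> b) = dia A a \<squnion> dia A b" if "a \<in> C" "b \<in> C" for a b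
    using mA that by (simp add: modal_algebra_def)
  have dia_zero [simp]: "dia A \<zero> = \<zero>" using mA by (simp add: modal_algebra_def)
  have dia_ext: "a \<squnion> dia A a = dia A a" and dia_dia: "dia A (dia A a) \<squnion> dia A a = dia A a"
    if "a \<in> C" for a using A(1) that by (simp_all add: closure_algebra_def leq_def)
  define X where "X = ultrafilters A"
  note X = ultrafiltersD[where A = A, folded X_def]
  note eqI = eq_by_ultrafilters[folded X_def]
  define R where "R = {(u, v). u \<in> X \<and> v \<in> X \<and> (\<forall>a\<in>v. dia A a \<in> u)}"
  define hat where "hat a = {u \<in> X. a \<in> u}" for a
  have ext: "dia A a \<in> u" if "u \<in> X" "a \<in> u" for u a
    using dia_ext[of a] X[OF that(1)] that(2) by (metis dia_C)
  have dd: "dia A a \<in> u" if "u \<in> X" "a \<in> C" "dia A (dia A a) \<in> u" for u a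
    using dia_dia[of a] X[OF that(1)] that(2,3) by (metis dia_C)
  have refl: "(u, u) \<in> R" if "u \<in> X" for u using that ext by (auto simp: R_def)
  have trans: "(u, w) \<in> R" if "(u, v) \<in> R" "(v, w) \<in> R" for u v w
  proof -
    have uvw: "u \<in> X" "v \<in> X" "w \<in> X" using that by (auto simp: R_def)
    have "dia A a \<in> u" if a: "a \<in> w" for a
      using that \<open>(u, v) \<in> R\<close> \<open>(v, w) \<in> R\<close> dd[OF uvw(1) X(3)[OF uvw(3) a]] unfolding R_def by blast
    then show ?thesis using uvw by (simp add: R_def)
  qed
  have witness: "\<exists>v. (u, v) \<in> R \<and> a \<in> v" if u: "u \<in> X" "dia A a \<in> u" and a: "a \<in> C" for u a
  proof -
    \<comment> \<open>An ultrafilter containing these elements contains \<open>a\<close> (take \<open>c = 0\<close>) and no \<open>c\<close> with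
      \<open>\<diamond>c \<notin> u\<close>, so \<open>u\<close> sees it.\<close>
    define F where "F = {\<ominus> c \<sqinter> a |c. c \<in> C \<and> dia A c \<notin> u}"
    have "\<zero> \<notin> F"
    proof
      assume "\<zero> \<in> F"
      then obtain c where c: "c \<in> C" "dia A c \<notin> u" "\<ominus> c \<sqinter> a = \<zero>" by (auto simp: F_def)
      have "a \<squnion> c = c"
      proof (rule eqI)
        show "a \<squnion> c \<in> w \<longleftrightarrow> c \<in> w" if w: "w \<in> X" for w
          using X[OF w] a c by (metis closed(3))
      qed (use a c in auto)
      then have "dia A a \<squnion> dia A c = dia A c" using dia_J a c by metis
      then show False using X(6)[OF u(1)] u(2) a c by (metis dia_C)
    qed
    moreover have "x \<sqinter> y \<in> F" if xy: "x \<in> F" "y \<in> F" for x y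
    proof -
      obtain c where c: "c \<in> C" "dia A c \<notin> u" "x = \<ominus> c \<sqinter> a" using xy(1) by (auto simp: F_def)
      obtain d where d: "d \<in> C" "dia A d \<notin> u" "y = \<ominus> d \<sqinter> a" using xy(2) by (auto simp: F_def)
      note cd = c d
      have "x \<sqinter> y = \<ominus> (c \<squnion> d) \<sqinter> a"
        by (rule eqI) (use cd a X(4-6) in auto)
      moreover have "dia A (c \<squnion> d) \<notin> u" using cd dia_J X(6)[OF u(1)] by simp
      ultimately show ?thesis using cd by (auto simp: F_def)
    qed
    moreover have "F \<subseteq> C" using a by (auto simp: F_def)
    ultimately obtain v where v: "v \<in> X" "F \<subseteq> v" unfolding X_def by (rule_tac ultrafilter_exists[of F])
    have F: "c \<notin> v \<and> a \<in> v" if "c \<in> C" "dia A c \<notin> u" for c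
    proof -
      have "\<ominus> c \<sqinter> a \<in> v" using v(2) that by (auto simp: F_def)
      then show ?thesis using X[OF v(1)] a that by simp
    qed
    have "a \<in> v" using F[of \<zero>] X(2)[OF u(1)] by simp
    moreover have "dia A b \<in> u" if "b \<in> v" for b using F[of b] X(3)[OF v(1)] that by blast
    ultimately show ?thesis using u v by (auto simp: R_def)
  qed
  define P where "P = hat ` C"
  have dia_iff: "dia A a \<in> u \<longleftrightarrow> (\<exists>v. (u, v) \<in> R \<and> a \<in> v)" if "u \<in> X" "a \<in> C" for u a
    using witness that by (auto simp: R_def)
  have hat_dia: "hat (dia A a) = R\<inverse> `` hat a" if "a \<in> C" for a
    using dia_iff that by (auto simp: hat_def R_def)
  have hats: "hat \<zero> = {}" "hat \<one> = X" "\<And>a. a \<in> C \<Longrightarrow> hat (\<ominus> a) = X - hat a"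
    "\<And>a b. a \<in> C \<Longrightarrow> b \<in> C \<Longrightarrow> hat (a \<squnion> b) = hat a \<union> hat b"
    "\<And>a b. a \<in> C \<Longrightarrow> b \<in> C \<Longrightarrow> hat (a \<sqinter> b) = hat a \<inter> hat b"
    using X(1,2) by (auto simp: hat_def X(4-6))
  have hat_inj: "a = b" if "a \<in> C" "b \<in> C" "hat a = hat b" for a b
    using that by (intro eqI) (auto simp: hat_def)
  have sub: "subalgebra P (frame_alg X R)"
    unfolding subalgebra_def
  proof (intro conjI ballI)
    show "P \<subseteq> carrier (frame_alg X R)" by (auto simp: P_def hat_def)
    show "zero (frame_alg X R) \<in> P" "one (frame_alg X R) \<in> P"
      using imageI[OF closed(1), of hat] imageI[OF closed(2), of hat] by (auto simp: P_def hats)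
  next
    fix a assume "a \<in> P"
    then obtain x where x: "x \<in> C" "a = hat x" by (auto simp: P_def)
    show "compl (frame_alg X R) a \<in> P" "dia (frame_alg X R) a \<in> P"
      using x imageI[of "\<ominus> x" C hat] imageI[of "dia A x" C hat] by (auto simp: P_def hats hat_dia)
    fix b assume "b \<in> P"
    then obtain y where y: "y \<in> C" "b = hat y" by (auto simp: P_def)
    show "join (frame_alg X R) a b \<in> P" "meet (frame_alg X R) a b \<in> P"
      using x y imageI[of "x \<squnion> y" C hat] imageI[of "x \<sqinter> y" C hat] by (auto simp: P_def hats)
  qed
  have hom: "alg_hom hat A (frame_sub X R P)"
    unfolding alg_hom_def by (auto simp: hats hat_dia P_def)
  have "X \<noteq> {}" using hat_inj[of \<zero> \<one>] zero_neq_one by (auto simp: hats)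
  moreover have "preorder_on X R"
    unfolding preorder_on_def by (auto intro: refl_onI transI refl trans) (auto simp: R_def)
  ultimately have "general_S4_frame X R P" using sub by (simp add: general_S4_frame_def)
  moreover have "frame_logic X R P = logic_of A"
    unfolding frame_logic_def using hom closed_alg_modal[OF mA] hat_inj[of _ \<one>]
    by (intro logic_of_iso[of A hat]) (auto simp: P_def hats)
  moreover have "connected_alg (frame_sub X R P)"
    unfolding connected_alg_def
  proof (intro ballI impI)
    fix b assume "b \<in> carrier (frame_sub X R P)"
    then obtain a where a: "a \<in> C" "b = hat a" by (auto simp: P_def)
    assume "box (frame_sub X R P) b = b \<and> dia (frame_sub X R P) b = b"
    then have "hat (box A a) = hat a" "hat (dia A a) = hat a"
      using a by (auto simp: box_def hats hat_dia)
    then have "box A a = a" "dia A a = a" using a hat_inj by (auto simp: box_def)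
    then have "a = \<zero> \<or> a = \<one>" using A(2) a by (auto simp: connected_alg_def)
    then show "b = zero (frame_sub X R P) \<or> b = one (frame_sub X R P)"
      using a by (auto simp: hats)
  qed
  moreover have "tight X R P"
    unfolding tight_def
  proof (intro ballI impI)
    fix x y assume xy: "x \<in> X" "y \<in> X" and *: "\<forall>a\<in>P. y \<in> a \<longrightarrow> x \<in> R\<inverse> `` a"
    have "dia A a \<in> x" if a: "a \<in> y" for a
    proof -
      have aC: "a \<in> C" using X(3)[OF xy(2) a] .
      then have "x \<in> R\<inverse> `` hat a" using * xy a by (auto simp: P_def hat_def)
      then show ?thesis using hat_dia[OF aC] by (auto simp: hat_def)
    qed
    then show "(x, y) \<in> R" using xy by (auto simp: R_def)
  qed
  moreover have "\<forall>u\<in>X. \<exists>d. (u, d) \<in> R \<and> final_in R d"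
  proof -
    have *: "\<exists>d. (u, d) \<in> R \<and> final_in R d" if u: "u \<in> X" for u
    proof -
      \<comment> \<open>\<open>B\<close> forces the ultrafilter above \<open>u\<close>. \<open>D\<close> consists of the elements with dense interior; it
        contains \<open>\<not>a \<or> \<box>\<diamond>a\<close> for every \<open>a\<close>, and membership of these elements makes an ultrafilter
        final. Finite intersections of sets with dense interior have dense interior, which gives the
        finite intersection property.\<close>
      define B where "B = {b \<in> C. \<forall>y. (u, y) \<in> R \<longrightarrow> b \<in> y}"
      define D where "D = {c \<in> C. \<forall>x\<in>X. \<exists>y. (x, y) \<in> R \<and> (\<forall>z. (y, z) \<in> R \<longrightarrow> c \<in> z)}"
      define F where "F = {b \<sqinter> c |b c. b \<in> B \<and> c \<in> D}"
      have RX: "x \<in> X \<and> y \<in> X" if "(x, y) \<in> R" for x y using that by (auto simp: R_def)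
      have "\<zero> \<notin> F"
      proof
        assume "\<zero> \<in> F"
        then obtain b c where bc: "b \<in> B" "c \<in> D" "\<zero> = b \<sqinter> c" by (auto simp: F_def)
        obtain y where y: "(u, y) \<in> R" "\<forall>z. (y, z) \<in> R \<longrightarrow> c \<in> z" using bc(2) u by (auto simp: D_def)
        then have "y \<in> X" "c \<in> y" "b \<in> y" using RX refl bc(1) by (auto simp: B_def)
        then show False using X[of y] bc(3) by (metis)
      qed
      moreover have "x \<sqinter> y \<in> F" if xy: "x \<in> F" "y \<in> F" for x y
      proof -
        obtain b c where bc1: "b \<in> B" "c \<in> D" "x = b \<sqinter> c" using xy(1) by (auto simp: F_def)
        obtain b' c' where bc2: "b' \<in> B" "c' \<in> D" "y = b' \<sqinter> c'" using xy(2) by (auto simp: F_def)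
        note bc = bc1 bc2
        then have C: "b \<in> C" "c \<in> C" "b' \<in> C" "c' \<in> C" by (auto simp: B_def D_def)
        have "x \<sqinter> y = b \<sqinter> b' \<sqinter> (c \<sqinter> c')" using bc C by (intro eqI) (auto simp: X(4-6))
        moreover have "b \<sqinter> b' \<in> B" using bc C RX by (auto simp: B_def X(5))
        moreover have "\<exists>w. (x, w) \<in> R \<and> (\<forall>z. (w, z) \<in> R \<longrightarrow> c \<sqinter> c' \<in> z)" if x: "x \<in> X" for x
        proof -
          obtain y where y: "(x, y) \<in> R" "\<forall>z. (y, z) \<in> R \<longrightarrow> c \<in> z" using bc(2) x by (auto simp: D_def)
          then obtain w where w: "(y, w) \<in> R" "\<forall>z. (w, z) \<in> R \<longrightarrow> c' \<in> z" using bc(5) RX by (force simp: D_def)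
          have "(x, w) \<in> R" using trans y w by blast
          moreover have "c \<sqinter> c' \<in> z" if z: "(w, z) \<in> R" for z
            using y w z trans[OF w(1) z] RX[OF z] X(5)[of z c c'] C by blast
          ultimately show ?thesis by blast
        qed
        then have "c \<sqinter> c' \<in> D" using C by (auto simp: D_def)
        ultimately show ?thesis by (auto simp: F_def)
      qed
      moreover have "F \<subseteq> C" by (auto simp: F_def B_def D_def)
      ultimately obtain d where d: "d \<in> X" "F \<subseteq> d" unfolding X_def by (rule_tac ultrafilter_exists[of F])
      have "\<one> \<in> B" using X(1) RX by (auto simp: B_def)
      moreover have "\<one> \<in> D" unfolding D_def using X(1) RX refl closed(2) by blast
      ultimately have one: "\<one> \<in> B" "\<one> \<in> D" by auto
      have Bd: "b \<in> d" if "b \<in> B" for b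
      proof -
        have "b \<sqinter> \<one> \<in> F" using that one(2) unfolding F_def by blast
        then show ?thesis using d that by (auto simp: B_def)
      qed
      have Dd: "c \<in> d" if "c \<in> D" for c
      proof -
        have "\<one> \<sqinter> c \<in> F" using that one(1) unfolding F_def by blast
        then show ?thesis using d that by (auto simp: D_def)
      qed
      have "dia A a \<in> u" if a: "a \<in> d" for a
      proof (rule ccontr)
        assume n: "dia A a \<notin> u"
        have aC: "a \<in> C" using X(3)[OF d(1) a] .
        then have "\<ominus> a \<in> B" using n dia_iff[OF u aC] RX X(4) by (auto simp: B_def)
        then show False using Bd X(4)[OF d(1) aC] a by blast
      qed
      then have "(u, d) \<in> R" using u d by (auto simp: R_def)
      moreover have "(y, d) \<in> R" if y: "(d, y) \<in> R" for y
      proof -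
        have yX: "y \<in> X" using RX y by blast
        have "dia A a \<in> y" if a: "a \<in> d" for a
        proof (rule ccontr)
          assume n: "dia A a \<notin> y"
          have aC: "a \<in> C" using X(3)[OF d(1) a] .
          let ?b = "\<ominus> dia A (\<ominus> dia A a)"
          \<comment> \<open>Either some point above \<open>x\<close> sees no \<open>a\<close>, and everything above that point satisfies \<open>\<not>a\<close>, or
            every point above \<open>x\<close> satisfies \<open>\<box>\<diamond>a\<close>.\<close>
          have "\<exists>w. (x, w) \<in> R \<and> (\<forall>z. (w, z) \<in> R \<longrightarrow> \<ominus> a \<squnion> ?b \<in> z)" if x: "x \<in> X" for x
          proof (cases "\<exists>y. (x, y) \<in> R \<and> (\<forall>z. (y, z) \<in> R \<longrightarrow> a \<notin> z)")
            case True
            then show ?thesis using RX X(4,6) aC by (metis closed(3) dia_C)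
          next
            case False
            have "\<ominus> a \<squnion> ?b \<in> z" if z: "(x, z) \<in> R" for z
            proof -
              have "\<not> (\<exists>z'. (z, z') \<in> R \<and> \<ominus> dia A a \<in> z')"
              proof
                assume "\<exists>z'. (z, z') \<in> R \<and> \<ominus> dia A a \<in> z'"
                then obtain z' where z': "(z, z') \<in> R" "\<ominus> dia A a \<in> z'" by blast
                then have "\<forall>z''. (z', z'') \<in> R \<longrightarrow> a \<notin> z''"
                  using dia_iff[of z' a] RX X(4)[of z' "dia A a"] aC by auto
                then show False using False trans[OF z z'(1)] by blast
              qed
              then have "dia A (\<ominus> dia A a) \<notin> z" using dia_iff[of z "\<ominus> dia A a"] RX[OF z] aC by simp
              then show ?thesis using X(4,6)[of z] RX[OF z] aC by simp
            qed
            then show ?thesis using refl x by blast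
          qed
          then have "\<ominus> a \<squnion> ?b \<in> d" using Dd aC by (simp add: D_def)
          then have "dia A (\<ominus> dia A a) \<notin> d" using X(4,6)[OF d(1)] a aC by simp
          moreover have "\<ominus> dia A a \<in> y" using n X(4)[OF yX] aC by simp
          ultimately show False using dia_iff[of d "\<ominus> dia A a"] y d(1) aC by auto
        qed
        then show ?thesis using yX d by (auto simp: R_def)
      qed
      ultimately show ?thesis by (auto simp: final_in_def)
    qed
    show ?thesis by (intro ballI *)
  qed
  ultimately show ?thesis by (rule that)
qed

section \<open>Countable path-connected frames\<close>

lemma logic_of_hom_image:
  assumes "closed_alg A" "alg_hom h A B"
    and "\<And>a. a \<in> carrier A \<Longrightarrow> h a = one B \<Longrightarrow> a = one A"
  shows "subalgebra (h ` carrier A) B" "logic_of (restrict_alg B (h ` carrier A)) = logic_of A"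
proof -
  have cl: "zero A \<in> carrier A" "one A \<in> carrier A"
    "\<And>a. a \<in> carrier A \<Longrightarrow> compl A a \<in> carrier A" "\<And>a. a \<in> carrier A \<Longrightarrow> dia A a \<in> carrier A"
    "\<And>a b. a \<in> carrier A \<Longrightarrow> b \<in> carrier A \<Longrightarrow> join A a b \<in> carrier A"
    "\<And>a b. a \<in> carrier A \<Longrightarrow> b \<in> carrier A \<Longrightarrow> meet A a b \<in> carrier A"
    using assms(1) by (auto simp: subalgebra_def)
  have h: "h ` carrier A \<subseteq> carrier B" "h (zero A) = zero B" "h (one A) = one B"
    "\<And>a. a \<in> carrier A \<Longrightarrow> compl B (h a) = h (compl A a)"
    "\<And>a. a \<in> carrier A \<Longrightarrow> dia B (h a) = h (dia A a)"
    "\<And>a b. a \<in> carrier A \<Longrightarrow> b \<in> carrier A \<Longrightarrow> join B (h a) (h b) = h (join A a b)"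
    "\<And>a b. a \<in> carrier A \<Longrightarrow> b \<in> carrier A \<Longrightarrow> meet B (h a) (h b) = h (meet A a b)"
    using assms(2) by (auto simp: alg_hom_def)
  show "subalgebra (h ` carrier A) B"
    unfolding subalgebra_def using h(1) cl
    by (auto simp: h(4-7) simp flip: h(2,3))
  show "logic_of (restrict_alg B (h ` carrier A)) = logic_of A"
    using assms by (intro logic_of_iso[of A h]) (auto simp: alg_hom_def)
qed

text \<open>A path visits finitely many points, so a countable set of points can be closed under chosen paths.\<close>
lemma finite_path:
  assumes "(u, v) \<in> T\<^sup>*" "u \<in> W" "T \<subseteq> W \<times> W"
  shows "\<exists>Q. finite Q \<and> Q \<subseteq> W \<and> (u, v) \<in> (T \<inter> Q \<times> Q)\<^sup>*"
  using assms(1)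
proof induction
  case base
  then show ?case by (intro exI[of _ "{}"]) auto
next
  case (step y z)
  then obtain Q where Q: "finite Q" "Q \<subseteq> W" "(u, y) \<in> (T \<inter> Q \<times> Q)\<^sup>*" by blast
  let ?Q = "insert y (insert z Q)"
  have "(u, y) \<in> (T \<inter> ?Q \<times> ?Q)\<^sup>*" using Q(3) by (rule set_rev_mp) (rule rtrancl_mono, auto)
  moreover have "(y, z) \<in> T \<inter> ?Q \<times> ?Q" using step by auto
  ultimately have "(u, z) \<in> (T \<inter> ?Q \<times> ?Q)\<^sup>*" by (rule rtrancl_into_rtrancl)
  moreover have "?Q \<subseteq> W" using Q step assms(3) by auto
  ultimately show ?case using Q(1) by (intro exI[of _ ?Q]) auto
qed

lemma rtrancl_hom:
  assumes "\<And>x y. (x, y) \<in> r \<Longrightarrow> (f x, f y) \<in> s" "(x, y) \<in> r\<^sup>*"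
  shows "(f x, f y) \<in> s\<^sup>*"
  using assms(2) by induction (auto intro: rtrancl_into_rtrancl assms(1))

text \<open>Downward Loewenheim--Skolem for frames: restrict a countable subalgebra with the same logic to a
  countable set of points that contains a point of every nonempty member, a successor witnessing every
  \<open>x \<in> R\<inverse> `` a\<close>, and a path between any two of its points.\<close>
lemma countable_frame_transfer:
  fixes W :: "'x set"
  assumes fr: "general_S4_frame W R P" and pc: "path_connected_frame W R"
  shows "logic_of_countable_path_connected_frame TYPE('b::infinite) (frame_logic W R P)"
proof -
  have sub: "subalgebra P (frame_alg W R)" and ne: "W \<noteq> {}" and pre: "preorder_on W R"
    using fr by (auto simp: general_S4_frame_def)
  have RW: "R \<subseteq> W \<times> W" and refl: "\<And>x. x \<in> W \<Longrightarrow> (x, x) \<in> R" and tr: "trans R"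
    using pre by (auto simp: preorder_on_def refl_on_def)
  obtain C where "subalgebra C (frame_sub W R P)" and C: "countable C"
    and logC: "logic_of (restrict_alg (frame_sub W R P) C) = logic_of (frame_sub W R P)"
    using countable_subalgebra[OF closed_alg_restrict[OF sub]] .
  then have subC: "subalgebra C (frame_alg W R)" using sub by (auto simp: subalgebra_def)
  have "restrict_alg (frame_sub W R P) C = frame_sub W R C" by (simp add: restrict_alg_def)
  then have logC: "logic_of (frame_sub W R C) = frame_logic W R P"
    using logC by (simp only: frame_logic_def)
  have CW: "a \<subseteq> W" and C_compl: "W - a \<in> C" if "a \<in> C" for a
    using subC that by (auto simp: subalgebra_def)
  have "\<forall>x a. x \<in> R\<inverse> `` a \<longrightarrow> (\<exists>y. (x, y) \<in> R \<and> y \<in> a)" by blast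
  then obtain wit where wit: "\<And>x a. x \<in> R\<inverse> `` a \<Longrightarrow> (x, wit x a) \<in> R \<and> wit x a \<in> a" by metis
  have "\<forall>u v. u \<in> W \<and> v \<in> W \<longrightarrow>
      (\<exists>Q. finite Q \<and> Q \<subseteq> W \<and> (u, v) \<in> ((R \<union> R\<inverse>) \<inter> Q \<times> Q)\<^sup>*)"
  proof (intro allI impI)
    fix u v assume uv: "u \<in> W \<and> v \<in> W"
    then have "(u, v) \<in> (R \<union> R\<inverse>)\<^sup>*" using pc unfolding path_connected_frame_def by blast
    then show "\<exists>Q. finite Q \<and> Q \<subseteq> W \<and> (u, v) \<in> ((R \<union> R\<inverse>) \<inter> Q \<times> Q)\<^sup>*"
      by (rule finite_path) (use RW uv in auto)
  qed
  then obtain pth where pth: "\<And>u v. u \<in> W \<Longrightarrow> v \<in> W \<Longrightarrow> finite (pth u v)"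
    "\<And>u v. u \<in> W \<Longrightarrow> v \<in> W \<Longrightarrow> pth u v \<subseteq> W"
    "\<And>u v. u \<in> W \<Longrightarrow> v \<in> W \<Longrightarrow> (u, v) \<in> ((R \<union> R\<inverse>) \<inter> pth u v \<times> pth u v)\<^sup>*" by metis
  define S where "S = (\<lambda>a. SOME x. x \<in> a) ` (C - {{}})"
  have some: "(SOME x. x \<in> a) \<in> a" if "a \<noteq> {}" for a :: "'x set" using that by (auto intro: someI_ex)
  define F where "F x y = pth x y \<union> wit x ` {a \<in> C. x \<in> R\<inverse> `` a}" for x y
  have S: "countable S" "S \<subseteq> W" using C some CW by (auto simp: S_def)
  obtain V where V: "countable V" "S \<subseteq> V" "V \<subseteq> W" "\<forall>x\<in>V. \<forall>y\<in>V. F x y \<subseteq> V"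
  proof (rule countable_closure[OF S, of F])
    show "F x y \<subseteq> W" if "x \<in> W" "y \<in> W" for x y
      unfolding F_def using pth(2)[OF that] wit CW by blast
    show "countable (F x y)" if "x \<in> W" "y \<in> W" for x y
      unfolding F_def using pth(1)[OF that] C by (auto intro: countable_finite)
  qed
  obtain f :: "'x \<Rightarrow> 'b" where f: "inj_on f V" using infinite_type_embedding[OF V(1)] .
  have f_eq: "f x = f y \<longleftrightarrow> x = y" if "x \<in> V" "y \<in> V" for x y
    using f that by (simp add: inj_on_eq_iff)
  define W' where "W' = f ` V"
  define R' where "R' = {(f x, f y) |x y. x \<in> V \<and> y \<in> V \<and> (x, y) \<in> R}"
  define h where "h a = f ` (a \<inter> V)" for a
  have f_h: "f x \<in> h a \<longleftrightarrow> x \<in> a" if "x \<in> V" for x a using that by (auto simp: h_def f_eq)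
  have hW: "h a \<subseteq> W'" for a by (auto simp: h_def W'_def)
  have eqI: "A = B" if "A \<subseteq> W'" "B \<subseteq> W'" "\<And>x. x \<in> V \<Longrightarrow> f x \<in> A \<longleftrightarrow> f x \<in> B" for A B
    using that unfolding W'_def by blast
  have R'_f: "(f x, f y) \<in> R' \<longleftrightarrow> (x, y) \<in> R" if "x \<in> V" "y \<in> V" for x y
    using that by (auto simp: R'_def f_eq)
  have R'W: "R' \<subseteq> W' \<times> W'" by (auto simp: R'_def W'_def)
  have h_dia: "h (R\<inverse> `` a) = R'\<inverse> `` h a" if a: "a \<in> C" for a
  proof (rule eqI)
    fix x assume x: "x \<in> V"
    show "f x \<in> h (R\<inverse> `` a) \<longleftrightarrow> f x \<in> R'\<inverse> `` h a"
    proof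
      assume "f x \<in> h (R\<inverse> `` a)"
      then have *: "x \<in> R\<inverse> `` a" using f_h x by blast
      then have "wit x a \<in> F x x" using a by (auto simp: F_def)
      then have "wit x a \<in> V" using V(4) x by blast
      then show "f x \<in> R'\<inverse> `` h a" using wit[OF *] x f_h R'_f by blast
    next
      assume "f x \<in> R'\<inverse> `` h a"
      then obtain y where "(f x, y) \<in> R'" "y \<in> h a" by blast
      then obtain z where "z \<in> V" "y = f z" "z \<in> a" "(f x, f z) \<in> R'" by (auto simp: h_def)
      then show "f x \<in> h (R\<inverse> `` a)" using x f_h R'_f by blast
    qed
  qed (use hW R'W in auto)
  have "alg_hom h (frame_sub W R C) (frame_alg W' R')"
    unfolding alg_hom_def
  proof (intro conjI ballI)
    show "h ` carrier (frame_sub W R C) \<subseteq> carrier (frame_alg W' R')" using hW by auto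
    show "h (zero (frame_sub W R C)) = zero (frame_alg W' R')" by (simp add: h_def)
    show "h (one (frame_sub W R C)) = one (frame_alg W' R')"
      using V(3) by (simp add: h_def W'_def Int_absorb1)
    fix a assume a: "a \<in> carrier (frame_sub W R C)"
    show "h (compl (frame_sub W R C) a) = compl (frame_alg W' R') (h a)"
      using hW V(3) by (intro eqI) (auto simp: f_h W'_def)
    show "h (dia (frame_sub W R C) a) = dia (frame_alg W' R') (h a)" using a by (simp add: h_dia)
    fix b
    show "h (join (frame_sub W R C) a b) = join (frame_alg W' R') (h a) (h b)"
      "h (meet (frame_sub W R C) a b) = meet (frame_alg W' R') (h a) (h b)"
      unfolding frame_alg_simps restrict_alg_simps
      by (rule eqI; use hW[of a] hW[of b] hW in \<open>auto simp: f_h\<close>)+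
  qed
  moreover have "a = W" if a: "a \<in> C" "h a = W'" for a
  proof (rule ccontr)
    assume "a \<noteq> W"
    then have *: "W - a \<noteq> {}" using CW a by blast
    then have "(SOME x. x \<in> W - a) \<in> S"
      using C_compl[OF a(1)] unfolding S_def by (intro imageI) simp
    then have "f (SOME x. x \<in> W - a) \<in> h a" "(SOME x. x \<in> W - a) \<in> V" using V(2) a by (auto simp: W'_def)
    then show False using some[OF *] f_h[of "SOME x. x \<in> W - a" a] by simp
  qed
  ultimately have sub': "subalgebra (h ` C) (frame_alg W' R')"
    and log': "frame_logic W' R' (h ` C) = frame_logic W R P"
    using logic_of_hom_image[OF closed_alg_restrict[OF subC], of h "frame_alg W' R'"] logC
    by (simp_all add: frame_logic_def)
  have "preorder_on W' R'"
    unfolding preorder_on_def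
  proof (intro conjI)
    show "refl_on W' R'" using refl V(3) by (auto simp: refl_on_def R'_def W'_def)
    show "R' \<subseteq> W' \<times> W'" by (rule R'W)
    show "trans R'"
    proof (rule transI)
      fix x y z assume "(x, y) \<in> R'" "(y, z) \<in> R'"
      then obtain a b b' c where "x = f a" "y = f b" "y = f b'" "z = f c" "a \<in> V" "b \<in> V" "b' \<in> V" "c \<in> V"
        "(a, b) \<in> R" "(b', c) \<in> R" by (auto simp: R'_def)
      moreover from this have "b = b'" using f_eq by blast
      ultimately show "(x, z) \<in> R'" using transD[OF tr] R'_f by blast
    qed
  qed
  moreover have "W' \<noteq> {}"
  proof -
    have "(SOME x. x \<in> W) \<in> S" using ne subC by (auto simp: S_def subalgebra_def)
    then show ?thesis using V(2) by (auto simp: W'_def)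
  qed
  ultimately have "general_S4_frame W' R' (h ` C)" using sub' by (simp add: general_S4_frame_def)
  moreover have "countable W'" using V(1) by (simp add: W'_def)
  moreover have "path_connected_frame W' R'"
    unfolding path_connected_frame_def W'_def
  proof (intro ballI, elim imageE, hypsubst)
    fix u v assume uv: "u \<in> V" "v \<in> V"
    have "pth u v \<subseteq> V" using V(4) uv by (auto simp: F_def)
    then have edge: "(f x, f y) \<in> R' \<union> R'\<inverse>" if "(x, y) \<in> (R \<union> R\<inverse>) \<inter> pth u v \<times> pth u v" for x y
      using that R'_f by blast
    have "u \<in> W" "v \<in> W" using uv V(3) by auto
    then have "(u, v) \<in> ((R \<union> R\<inverse>) \<inter> pth u v \<times> pth u v)\<^sup>*" by (rule pth(3))
    with edge show "(f u, f v) \<in> (R' \<union> R'\<inverse>)\<^sup>*" by (rule rtrancl_hom)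
  qed
  ultimately show ?thesis
    unfolding logic_of_countable_path_connected_frame_def using log' by metis
qed

section \<open>Final points of a connected frame\<close>

primrec atoms :: "fm \<Rightarrow> nat set" where
  "atoms (Atom n) = {n}"
| "atoms Top = {}"
| "atoms Bot = {}"
| "atoms (Neg p) = atoms p"
| "atoms (Con p q) = atoms p \<union> atoms q"
| "atoms (Dis p q) = atoms p \<union> atoms q"
| "atoms (Imp p q) = atoms p \<union> atoms q"
| "atoms (Dia p) = atoms p"
| "atoms (Box p) = atoms p"

lemma finite_atoms [simp]: "finite (atoms p)"
  by (induction p) auto

locale general_frame =
  fixes W :: "'a set" and R :: "'a rel" and P :: "'a set set"
  assumes frame: "general_S4_frame W R P"
begin

lemma RW: "(x, y) \<in> R \<Longrightarrow> x \<in> W" "(x, y) \<in> R \<Longrightarrow> y \<in> W"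
  using frame by (auto simp: general_S4_frame_def preorder_on_def)

lemma R_refl: "x \<in> W \<Longrightarrow> (x, x) \<in> R"
  using frame by (auto simp: general_S4_frame_def preorder_on_def refl_on_def)

lemma R_trans: "(x, y) \<in> R \<Longrightarrow> (y, z) \<in> R \<Longrightarrow> (x, z) \<in> R"
  using frame by (auto simp: general_S4_frame_def preorder_on_def dest: transD)

lemma subalg: "subalgebra P (frame_alg W R)"
  using frame by (simp add: general_S4_frame_def)

lemma P_closed [intro]: "{} \<in> P" "W \<in> P" "a \<in> P \<Longrightarrow> W - a \<in> P" "a \<in> P \<Longrightarrow> R\<inverse> `` a \<in> P"
  "a \<in> P \<Longrightarrow> b \<in> P \<Longrightarrow> a \<union> b \<in> P" "a \<in> P \<Longrightarrow> b \<in> P \<Longrightarrow> a \<inter> b \<in> P"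
  using subalg by (auto simp: subalgebra_def)

lemma P_subset: "a \<in> P \<Longrightarrow> a \<subseteq> W"
  using subalg by (auto simp: subalgebra_def)

lemma P_finite_INT: "finite N \<Longrightarrow> (\<And>n. n \<in> N \<Longrightarrow> g n \<in> P) \<Longrightarrow> W \<inter> (\<Inter>n\<in>N. g n) \<in> P"
proof (induction N rule: finite_induct)
  case (insert n N)
  then have "g n \<inter> (W \<inter> (\<Inter>n\<in>N. g n)) \<in> P" by blast
  then show ?case by (simp add: Int_left_commute)
qed auto

lemma P_finite_UN: "finite N \<Longrightarrow> (\<And>n. n \<in> N \<Longrightarrow> g n \<in> P) \<Longrightarrow> (\<Union>n\<in>N. g n) \<in> P"
  by (induction N rule: finite_induct) auto

text \<open>Call the trace of a point on the sets \<open>V n\<close> with \<open>n \<in> N\<close> its colour. There are finitely many colours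
  and each is a member of \<open>P\<close>, so "the colours above this point are exactly those of the cluster of
  \<open>c\<close>, and all of them remain available" is expressible as \<open>\<box>(\<Inter>\<diamond>t \<inter> \<Union>t)\<close>, where \<open>t\<close> ranges
  over the colours above \<open>c\<close>.\<close>
lemma color_class:
  assumes N: "finite N" and V: "\<And>n. V n \<in> P" and c: "c \<in> W" "final_in R c"
  shows "\<exists>E. E \<in> P \<and> c \<in> E \<and> R `` E \<subseteq> E \<and>
      (\<forall>c'\<in>E. (\<forall>y. (c, y) \<in> R \<longrightarrow> (\<exists>y'. (c', y') \<in> R \<and> (\<forall>n\<in>N. y \<in> V n \<longleftrightarrow> y' \<in> V n))) \<and>
        (\<forall>y'. (c', y') \<in> R \<longrightarrow> (\<exists>y. (c, y) \<in> R \<and> (\<forall>n\<in>N. y \<in> V n \<longleftrightarrow> y' \<in> V n))))"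
proof -
  define col where "col t = W \<inter> (\<Inter>n\<in>N. if n \<in> t then V n else W - V n)" for t
  define T where "T = (\<lambda>y. N \<inter> {n. y \<in> V n}) ` {y. (c, y) \<in> R}"
  have "T \<subseteq> Pow N" by (auto simp: T_def)
  then have T: "finite T" using N by (simp add: finite_subset)
  have col: "y \<in> col t \<longleftrightarrow> y \<in> W \<and> (\<forall>n\<in>N. n \<in> t \<longleftrightarrow> y \<in> V n)" for y t
    by (auto simp: col_def)
  have colP: "col t \<in> P" for t unfolding col_def by (rule P_finite_INT[OF N]) (use V in auto)
  define G where "G = (W \<inter> (\<Inter>t\<in>T. R\<inverse> `` col t)) \<inter> (\<Union>t\<in>T. col t)"
  have "G \<in> P" unfolding G_def using T colP by (intro P_closed(6) P_finite_INT P_finite_UN) auto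
  define E where "E = W - R\<inverse> `` (W - G)"
  have E: "x \<in> E \<longleftrightarrow> x \<in> W \<and> (\<forall>y. (x, y) \<in> R \<longrightarrow> y \<in> G)" for x
    using RW by (auto simp: E_def)
  have G: "y \<in> G" if "(c, y) \<in> R" for y
  proof -
    have "y \<in> R\<inverse> `` col t" if "t \<in> T" for t
    proof -
      obtain z where z: "(c, z) \<in> R" "t = N \<inter> {n. z \<in> V n}" using \<open>t \<in> T\<close> by (auto simp: T_def)
      then have "(y, z) \<in> R" using c(2) \<open>(c, y) \<in> R\<close> R_trans by (auto simp: final_in_def)
      moreover have "z \<in> col t" using z RW by (auto simp: col)
      ultimately show ?thesis by blast
    qed
    moreover have "y \<in> col (N \<inter> {n. y \<in> V n})" using that RW by (auto simp: col)
    ultimately show ?thesis using that RW by (auto simp: G_def T_def)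
  qed
  show ?thesis
  proof (intro exI[of _ E] conjI ballI allI impI)
    show "E \<in> P" unfolding E_def using \<open>G \<in> P\<close> by blast
    show "c \<in> E" using G c E by blast
    have "y \<in> E" if "x \<in> E" "(x, y) \<in> R" for x y
      using that(1) R_trans[OF that(2)] RW(2)[OF that(2)] unfolding E by blast
    then show "R `` E \<subseteq> E" by blast
    show "\<exists>y'. (c', y') \<in> R \<and> (\<forall>n\<in>N. y \<in> V n \<longleftrightarrow> y' \<in> V n)" if "c' \<in> E" "(c, y) \<in> R" for c' y
    proof -
      have "c' \<in> G" using that E R_refl by blast
      moreover have "N \<inter> {n. y \<in> V n} \<in> T" using that by (auto simp: T_def)
      ultimately obtain y' where "(c', y') \<in> R" "y' \<in> col (N \<inter> {n. y \<in> V n})" by (auto simp: G_def)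
      then show ?thesis by (auto simp: col)
    qed
    show "\<exists>y. (c, y) \<in> R \<and> (\<forall>n\<in>N. y \<in> V n \<longleftrightarrow> y' \<in> V n)" if "c' \<in> E" "(c', y') \<in> R" for c' y'
    proof -
      have "y' \<in> G" using that E by blast
      then obtain t where t: "t \<in> T" "y' \<in> col t" by (auto simp: G_def)
      then obtain y where "(c, y) \<in> R" "t = N \<inter> {n. y \<in> V n}" by (auto simp: T_def)
      then show ?thesis using t by (auto simp: col)
    qed
  qed
qed

end

locale connected_frame = general_frame +
  assumes connected: "connected_alg (frame_sub W R P)"
    and tight: "tight W R P"
    and final_above: "x \<in> W \<Longrightarrow> \<exists>d. (x, d) \<in> R \<and> final_in R d"
begin

text \<open>The only use of connectedness of the algebra. The set \<open>\<diamond>e\<close> is closed; if it is neither empty nor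
  everything then it is not open, so some point of \<open>\<diamond>e\<close> sees a point outside \<open>\<diamond>e\<close>. Going up to final
  points from either side produces the fork.\<close>
lemma dense_or_fork:
  assumes e: "e \<in> P" "e \<noteq> {}" "R `` e \<subseteq> e"
  shows "R\<inverse> `` e = W \<or>
    (\<exists>z d' d. (z, d') \<in> R \<and> (z, d) \<in> R \<and> final_in R d' \<and> final_in R d \<and> d' \<in> e \<and> d \<notin> R\<inverse> `` e)"
proof (rule disjCI)
  let ?D = "R\<inverse> `` e"
  assume neg: "\<not> (\<exists>z d' d. (z, d') \<in> R \<and> (z, d) \<in> R \<and> final_in R d' \<and> final_in R d \<and> d' \<in> e \<and> d \<notin> ?D)"
  have eD: "e \<subseteq> ?D" using P_subset[OF e(1)] R_refl by blast
  have "R\<inverse> `` ?D = ?D" using R_trans R_refl RW by blast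
  moreover have "W - R\<inverse> `` (W - ?D) = ?D"
  proof
    show "W - R\<inverse> `` (W - ?D) \<subseteq> ?D" using R_refl by blast
    show "?D \<subseteq> W - R\<inverse> `` (W - ?D)"
    proof
      fix z assume z: "z \<in> ?D"
      have False if z': "(z, z') \<in> R" "z' \<notin> ?D" for z'
      proof -
        obtain d where d: "(z', d) \<in> R" "final_in R d" using final_above RW z' by blast
        obtain y where y: "(z, y) \<in> R" "y \<in> e" using z by blast
        obtain d' where d': "(y, d') \<in> R" "final_in R d'" using final_above RW y by blast
        have "d \<notin> ?D" using d(1) z'(2) R_trans by blast
        moreover have "d' \<in> e" using e(3) y(2) d'(1) by blast
        moreover have "(z, d') \<in> R" using R_trans y(1) d'(1) .
        moreover have "(z, d) \<in> R" using R_trans z'(1) d(1) .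
        ultimately show False using neg d(2) d'(2) by blast
      qed
      then show "z \<in> W - R\<inverse> `` (W - ?D)" using z RW by blast
    qed
  qed
  moreover have "?D \<in> P" using e(1) by (rule P_closed(4))
  ultimately have "?D = {} \<or> ?D = W"
    using bspec[OF connected[unfolded connected_alg_def], of ?D] by simp
  then show "?D = W" using eD e(2) by blast
qed

text \<open>Take \<open>e = \<box>\<diamond>a\<close> for a set \<open>a\<close> that contains \<open>d1\<close> and is not seen by \<open>d2\<close>.\<close>
lemma separate_finals:
  assumes "d1 \<in> W" "final_in R d1" "d2 \<in> W" "(d2, d1) \<notin> R"
  shows "\<exists>e. e \<in> P \<and> d1 \<in> e \<and> R `` e \<subseteq> e \<and> (\<forall>y. (d2, y) \<in> R \<longrightarrow> y \<notin> e)"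
proof -
  obtain a where a: "a \<in> P" "d1 \<in> a" "d2 \<notin> R\<inverse> `` a" using assms tight unfolding tight_def by blast
  define e where "e = W - R\<inverse> `` (W - R\<inverse> `` a)"
  have e: "x \<in> e \<longleftrightarrow> x \<in> W \<and> (\<forall>y. (x, y) \<in> R \<longrightarrow> y \<in> R\<inverse> `` a)" for x
    unfolding e_def using RW by blast
  show ?thesis
  proof (intro exI[of _ e] conjI allI impI)
    show "e \<in> P" unfolding e_def using a by blast
    show "d1 \<in> e" using assms a by (auto simp: e final_in_def)
    have "y \<in> e" if "x \<in> e" "(x, y) \<in> R" for x y
      using that(1) R_trans[OF that(2)] RW(2)[OF that(2)] unfolding e by blast
    then show "R `` e \<subseteq> e" by blast
    show "y \<notin> e" if "(d2, y) \<in> R" for y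
    proof
      assume "y \<in> e"
      then have "y \<in> R\<inverse> `` a" using R_refl[OF RW(2)[OF that]] unfolding e by blast
      then show False using a(3) R_trans[OF that] by blast
    qed
  qed
qed

text \<open>An open set separating two unrelated final points would be neither dense nor the source of a fork,
  hence all final points form one cluster, which every point sees.\<close>
lemma path_connected_no_fork:
  assumes "\<And>z d1 d2. (z, d1) \<in> R \<Longrightarrow> (z, d2) \<in> R \<Longrightarrow> final_in R d1 \<Longrightarrow> final_in R d2 \<Longrightarrow> (d2, d1) \<in> R"
  shows "path_connected_frame W R"
proof -
  have finals: "(d2, d1) \<in> R" if d: "d1 \<in> W" "d2 \<in> W" "final_in R d1" "final_in R d2" for d1 d2
  proof (rule ccontr)
    assume "(d2, d1) \<notin> R"
    then obtain e where e: "e \<in> P" "d1 \<in> e" "R `` e \<subseteq> e" "\<And>y. (d2, y) \<in> R \<Longrightarrow> y \<notin> e"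
      using separate_finals[of d1 d2] d by blast
    have "e \<noteq> {}" using e(2) by blast
    from dense_or_fork[OF e(1) this e(3)]
    consider "R\<inverse> `` e = W" | z d' d where "(z, d') \<in> R" "(z, d) \<in> R" "final_in R d'" "final_in R d"
      "d' \<in> e" "d \<notin> R\<inverse> `` e" by blast
    then show False
    proof cases
      case 1
      then show False using d(2) e(4) by blast
    next
      case 2
      then show False using assms by blast
    qed
  qed
  show ?thesis
    unfolding path_connected_frame_def
  proof (intro ballI)
    fix u v assume "u \<in> W" "v \<in> W"
    then obtain d d' where d: "(u, d) \<in> R" "final_in R d" "(v, d') \<in> R" "final_in R d'"
      using final_above[of u] final_above[of v] by blast
    have "(d, d') \<in> R" using finals[OF RW(2)[OF d(3)] RW(2)[OF d(1)] d(4,2)] .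
    then have "(u, d') \<in> R" using R_trans[OF d(1)] by blast
    then have "(u, d') \<in> R \<union> R\<inverse>" "(d', v) \<in> R \<union> R\<inverse>" using d(3) by auto
    then show "(u, v) \<in> (R \<union> R\<inverse>)\<^sup>*" by (rule converse_rtrancl_into_rtrancl[OF _ r_into_rtrancl])
  qed
qed

text \<open>Apply the dichotomy to the colour class \<open>E\<close> of a final point \<open>c\<close> above \<open>w\<close>. If it yields a fork,
  this fork is as required, with \<open>e = E\<close>. If \<open>E\<close> is dense, then all final points lie in \<open>E\<close>, and the
  given fork will do, with a separating set as \<open>e\<close>.\<close>
lemma fork_over_color:
  assumes fork: "(z0, d1) \<in> R" "(z0, d2) \<in> R" "final_in R d1" "final_in R d2" "(d2, d1) \<notin> R"
    and N: "finite N" and V: "\<And>n. V n \<in> P" and w: "w \<in> W"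
  shows "\<exists>c z c' d e. (w, c) \<in> R \<and> final_in R c \<and> (z, c') \<in> R \<and> final_in R c' \<and> (z, d) \<in> R \<and> final_in R d \<and>
    e \<in> P \<and> (\<forall>y. (c', y) \<in> R \<longrightarrow> y \<in> e) \<and> (\<forall>y. (d, y) \<in> R \<longrightarrow> y \<notin> e) \<and>
    (\<forall>y. (c, y) \<in> R \<longrightarrow> (\<exists>y'. (c', y') \<in> R \<and> (\<forall>n\<in>N. y \<in> V n \<longleftrightarrow> y' \<in> V n))) \<and>
    (\<forall>y'. (c', y') \<in> R \<longrightarrow> (\<exists>y. (c, y) \<in> R \<and> (\<forall>n\<in>N. y \<in> V n \<longleftrightarrow> y' \<in> V n)))"
proof -
  obtain c where c: "(w, c) \<in> R" "final_in R c" using final_above w by blast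
  have cW: "c \<in> W" using RW c by blast
  obtain E where EE: "E \<in> P \<and> c \<in> E \<and> R `` E \<subseteq> E \<and>
      (\<forall>c'\<in>E. (\<forall>y. (c, y) \<in> R \<longrightarrow> (\<exists>y'. (c', y') \<in> R \<and> (\<forall>n\<in>N. y \<in> V n \<longleftrightarrow> y' \<in> V n))) \<and>
        (\<forall>y'. (c', y') \<in> R \<longrightarrow> (\<exists>y. (c, y) \<in> R \<and> (\<forall>n\<in>N. y \<in> V n \<longleftrightarrow> y' \<in> V n))))"
    using color_class[where V = V, OF N V cW c(2)] by (elim exE)
  then have E: "E \<in> P" "c \<in> E" "R `` E \<subseteq> E" by simp_all
  have "\<exists>z c' d e. (z, c') \<in> R \<and> final_in R c' \<and> (z, d) \<in> R \<and> final_in R d \<and> c' \<in> E \<and>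
    e \<in> P \<and> (\<forall>y. (c', y) \<in> R \<longrightarrow> y \<in> e) \<and> (\<forall>y. (d, y) \<in> R \<longrightarrow> y \<notin> e)"
  proof (cases "R\<inverse> `` E = W")
    case True
    then obtain y where "(d1, y) \<in> R" "y \<in> E" using RW fork by blast
    then have "d1 \<in> E" using E(3) fork(3) by (auto simp: final_in_def)
    moreover obtain e where "e \<in> P" "d1 \<in> e" "R `` e \<subseteq> e" "\<forall>y. (d2, y) \<in> R \<longrightarrow> y \<notin> e"
      using separate_finals[OF RW(2)[OF fork(1)] fork(3) RW(2)[OF fork(2)] fork(5)] by blast
    ultimately show ?thesis using fork by blast
  next
    case False
    have "E \<noteq> {}" using E(2) by blast
    from dense_or_fork[OF E(1) this E(3)] False
    obtain z d' d where "(z, d') \<in> R" "(z, d) \<in> R" "final_in R d'" "final_in R d"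
      "d' \<in> E" "d \<notin> R\<inverse> `` E" by auto
    then show ?thesis using E(1,3) by blast
  qed
  then obtain z c' d e where x: "(z, c') \<in> R" "final_in R c'" "(z, d) \<in> R" "final_in R d" "c' \<in> E"
    "e \<in> P" "\<forall>y. (c', y) \<in> R \<longrightarrow> y \<in> e" "\<forall>y. (d, y) \<in> R \<longrightarrow> y \<notin> e" by blast
  show ?thesis
    by (rule exI[of _ c], rule exI[of _ z], rule exI[of _ c'], rule exI[of _ d], rule exI[of _ e])
      (use c x EE in simp)
qed

end

section \<open>Gluing generated subframes\<close>

text \<open>The subframes generated by the points \<open>root i\<close> are put side by side, and points are linked across
  them. The zigzag condition says that the links form a bisimulation between subframes; it is what
  makes the saturated sets closed under \<open>\<diamond>\<close>. Since only saturated sets are admitted, links act like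
  identifications, but no quotient has to be formed.\<close>
locale gluing = general_frame +
  fixes root :: "'i \<Rightarrow> 'a" and I :: "'i set" and link :: "('i \<times> 'a) rel"
  assumes I_nonempty: "I \<noteq> {}"
    and root: "i \<in> I \<Longrightarrow> root i \<in> W"
    and link_sym: "(p, q) \<in> link \<Longrightarrow> (q, p) \<in> link"
    and link_in: "((i, x), q) \<in> link \<Longrightarrow> i \<in> I \<and> (root i, x) \<in> R"
    and link_zigzag: "((i, x), (j, y)) \<in> link \<Longrightarrow> (x, x') \<in> R \<Longrightarrow>
      \<exists>y'. (y, y') \<in> R \<and> ((i, x'), (j, y')) \<in> link"
begin

definition points where "points = {(i, x). i \<in> I \<and> (root i, x) \<in> R}"

definition step where "step = {((i, x), (j, y)). i = j \<and> (i, x) \<in> points \<and> (x, y) \<in> R}"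

text \<open>The \<open>i\<close>-th component of \<open>a\<close> is \<open>b\<close>, cut down to the subframe generated by \<open>root i\<close>.\<close>
definition slice where
  "slice i a b \<longleftrightarrow> (\<forall>x. (i, x) \<in> a \<longleftrightarrow> (root i, x) \<in> R \<and> x \<in> b)"

definition admissible where
  "admissible = {a. a \<subseteq> points \<and> (\<forall>i\<in>I. \<exists>b\<in>P. slice i a b) \<and> link `` a \<subseteq> a}"

text \<open>The largest relation that agrees with \<open>step\<close> on admissible sets. It contains the composition of a
  step with a link, so links provide paths.\<close>
definition access where
  "access = {(p, q). p \<in> points \<and> q \<in> points \<and> (\<forall>a\<in>admissible. q \<in> a \<longrightarrow> p \<in> step\<inverse> `` a)}"

lemma step_in: "(p, q) \<in> step \<Longrightarrow> p \<in> points \<and> q \<in> points"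
  by (auto simp: step_def points_def dest: R_trans)

lemma step_subset_access: "step \<subseteq> access"
  using step_in by (auto simp: access_def)

lemma link_points: "(p, q) \<in> link \<Longrightarrow> p \<in> points \<and> q \<in> points"
  using link_in link_sym by (cases p; cases q) (fastforce simp: points_def)

lemma step_link_access: "(p, q) \<in> step \<Longrightarrow> (q, q') \<in> link \<Longrightarrow> (p, q') \<in> access"
  using step_in link_points link_sym unfolding access_def admissible_def by blast

lemma access_dia: "a \<in> admissible \<Longrightarrow> access\<inverse> `` a = step\<inverse> `` a"
  using step_subset_access by (auto simp: access_def)

lemma slice_compl: "slice i a b \<Longrightarrow> i \<in> I \<Longrightarrow> slice i (points - a) (W - b)"
  by (auto simp: slice_def points_def dest: RW)

lemma slice_step: "slice i a b \<Longrightarrow> i \<in> I \<Longrightarrow> slice i (step\<inverse> `` a) (R\<inverse> `` b)"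
  by (auto simp: slice_def step_def points_def dest: R_trans)

lemma slice_ops:
  "slice i a b \<Longrightarrow> slice i a' b' \<Longrightarrow> slice i (a \<union> a') (b \<union> b')"
  "slice i a b \<Longrightarrow> slice i a' b' \<Longrightarrow> slice i (a \<inter> a') (b \<inter> b')"
  "slice i {} {}" "i \<in> I \<Longrightarrow> slice i points W"
  by (auto simp: slice_def points_def dest: RW)

lemma step_saturated:
  assumes "link `` a \<subseteq> a"
  shows "link `` (step\<inverse> `` a) \<subseteq> step\<inverse> `` a"
proof
  fix q assume "q \<in> link `` (step\<inverse> `` a)"
  then obtain i x x' where x: "((i, x), q) \<in> link" "((i, x), (i, x')) \<in> step" "(i, x') \<in> a"
    by (auto simp: step_def)
  obtain j y where q: "q = (j, y)" by (cases q)
  obtain y' where y': "(y, y') \<in> R" "((i, x'), (j, y')) \<in> link"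
    using link_zigzag[OF x(1)[unfolded q]] x(2) by (auto simp: step_def)
  then have "(q, (j, y')) \<in> step" using x(1) q link_points by (auto simp: step_def)
  moreover have "(j, y') \<in> a" using assms x(3) y'(2) by blast
  ultimately show "q \<in> step\<inverse> `` a" by blast
qed

lemma admissible_subset: "a \<in> admissible \<Longrightarrow> a \<subseteq> points"
  by (simp add: admissible_def)

lemma admissible_closed:
  "{} \<in> admissible" "points \<in> admissible" "a \<in> admissible \<Longrightarrow> points - a \<in> admissible" "a \<in> admissible \<Longrightarrow> access\<inverse> `` a \<in> admissible"
  "a \<in> admissible \<Longrightarrow> b \<in> admissible \<Longrightarrow> a \<union> b \<in> admissible" "a \<in> admissible \<Longrightarrow> b \<in> admissible \<Longrightarrow> a \<inter> b \<in> admissible"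
proof -
  show "{} \<in> admissible" using slice_ops(3) by (auto simp: admissible_def)
  show "points \<in> admissible" using slice_ops(4) link_points by (auto simp: admissible_def)
  show "points - a \<in> admissible" if a: "a \<in> admissible"
  proof -
    have "\<exists>b\<in>P. slice i (points - a) b" if "i \<in> I" for i
      using a that slice_compl[of i a] unfolding admissible_def by blast
    moreover have "link `` (points - a) \<subseteq> points - a" using a link_points link_sym unfolding admissible_def by blast
    ultimately show ?thesis by (auto simp: admissible_def)
  qed
  show "access\<inverse> `` a \<in> admissible" if a: "a \<in> admissible"
  proof -
    have "\<exists>b\<in>P. slice i (step\<inverse> `` a) b" if "i \<in> I" for i
      using a that slice_step[of i a] unfolding admissible_def by blast
    moreover have "step\<inverse> `` a \<subseteq> points" using step_in by blast
    moreover have "link `` (step\<inverse> `` a) \<subseteq> step\<inverse> `` a" using a step_saturated by (simp add: admissible_def)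
    ultimately show ?thesis unfolding access_dia[OF a] by (simp add: admissible_def)
  qed
  assume ab: "a \<in> admissible" "b \<in> admissible"
  have "\<exists>c\<in>P. slice i (a \<union> b) c" "\<exists>c\<in>P. slice i (a \<inter> b) c" if i: "i \<in> I" for i
  proof -
    obtain c d where "c \<in> P" "d \<in> P" "slice i a c" "slice i b d" using ab i unfolding admissible_def by blast
    then show "\<exists>c\<in>P. slice i (a \<union> b) c" "\<exists>c\<in>P. slice i (a \<inter> b) c"
      using slice_ops(1,2) by blast+
  qed
  then show "a \<union> b \<in> admissible" "a \<inter> b \<in> admissible" using ab by (auto simp: admissible_def)
qed

lemma glued_subalgebra: "subalgebra admissible (frame_alg points access)"
  unfolding subalgebra_def using admissible_subset admissible_closed by auto

lemma glued_frame: "general_S4_frame points access admissible"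
proof -
  have "trans access"
  proof (rule transI)
    fix p q r assume pq: "(p, q) \<in> access" and qr: "(q, r) \<in> access"
    have "p \<in> step\<inverse> `` a" if a: "a \<in> admissible" "r \<in> a" for a
    proof -
      have "q \<in> access\<inverse> `` a" using qr a by blast
      then have "p \<in> step\<inverse> `` (access\<inverse> `` a)" using pq admissible_closed(4)[OF a(1)] by (auto simp: access_def)
      then have "p \<in> step\<inverse> `` (step\<inverse> `` a)" using access_dia[OF a(1)] by simp
      then show ?thesis by (auto simp: step_def dest: R_trans)
    qed
    then show "(p, r) \<in> access" using pq qr by (auto simp: access_def)
  qed
  moreover have "refl_on points access"
    using step_subset_access R_refl RW by (force simp: refl_on_def step_def points_def)
  moreover have "access \<subseteq> points \<times> points" by (auto simp: access_def)
  moreover have "points \<noteq> {}" using I_nonempty root R_refl by (auto simp: points_def)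
  ultimately show ?thesis
    by (simp add: general_S4_frame_def preorder_on_def glued_subalgebra)
qed

text \<open>Evaluation takes place in each component separately. The hypothesis is restricted to the letters of
  \<open>p\<close> because the valuation used for a refutation is empty on all other letters.\<close>
lemma slice_eval:
  assumes v: "\<And>n. v n \<in> admissible" and i: "i \<in> I"
    and "\<forall>n\<in>atoms p. slice i (v n) (v0 n)"
  shows "slice i (eval_fm (frame_alg points access) v p) (eval_fm (frame_alg W R) v0 p)"
  using assms(3)
proof (induction p)
  case (Dia p)
  have "eval_fm (frame_alg points access) v p \<in> admissible"
    using eval_closed[OF closed_alg_restrict[OF glued_subalgebra], of v p] v by simp
  then show ?case using Dia slice_step[OF _ i] by (simp add: access_dia)
next
  case (Box p)
  have "eval_fm (frame_alg points access) v p \<in> admissible"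
    using eval_closed[OF closed_alg_restrict[OF glued_subalgebra], of v p] v by simp
  then have "points - eval_fm (frame_alg points access) v p \<in> admissible" by (rule admissible_closed(3))
  then show ?case using Box slice_step[OF _ i] slice_compl[OF _ i] by (simp add: access_dia)
qed (auto intro!: slice_ops slice_compl i)

lemma glued_logic: "frame_logic W R P \<subseteq> frame_logic points access admissible"
proof
  fix p assume p: "p \<in> frame_logic W R P"
  have "eval_fm (frame_alg points access) v p = points" if v: "\<And>n. v n \<in> admissible" for v
  proof -
    have sub: "eval_fm (frame_alg points access) v p \<subseteq> points"
      using eval_closed[OF closed_alg_restrict[OF glued_subalgebra], of v p] v admissible_subset by simp
    moreover have "(i, x) \<in> eval_fm (frame_alg points access) v p" if ix: "(i, x) \<in> points" for i x
    proof -
      have i: "i \<in> I" using ix by (auto simp: points_def)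
      have "\<forall>n. \<exists>b\<in>P. slice i (v n) b" using v i by (auto simp: admissible_def)
      then obtain v0 where v0: "\<And>n. v0 n \<in> P" "\<And>n. slice i (v n) (v0 n)" by metis
      have "eval_fm (frame_alg W R) v0 p = W"
        using p v0(1) by (auto simp: frame_logic_def logic_of_def valid_in_def)
      moreover have "slice i (eval_fm (frame_alg points access) v p) (eval_fm (frame_alg W R) v0 p)"
        by (rule slice_eval) (use v i v0(2) in simp_all)
      ultimately have "slice i (eval_fm (frame_alg points access) v p) W" by simp
      then show ?thesis using ix RW by (auto simp: slice_def points_def)
    qed
    ultimately show ?thesis by auto
  qed
  then show "p \<in> frame_logic points access admissible"
    by (simp add: frame_logic_def logic_of_def valid_in_def)
qed

end

context connected_frame
begin

text \<open>For each formula \<open>p\<close> outside the logic there are two components, \<open>(p, False)\<close> generated by a point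
  \<open>w p\<close> refuting \<open>p\<close>, and \<open>(p, True)\<close> generated by a fork \<open>z p\<close>. The links of type 1 join the final
  cluster above \<open>w p\<close> to the final cluster above \<open>z p\<close> with the same colours; the links of type 2 join
  everything in the other final clusters above all the forks \<open>z p\<close>, which become the hub of the frame.\<close>
lemma glue_refutations:
  assumes fork: "(z0, d1) \<in> R" "(z0, d2) \<in> R" "final_in R d1" "final_in R d2" "(d2, d1) \<notin> R"
  shows "logic_of_countable_path_connected_frame TYPE('b::infinite) (frame_logic W R P)"
proof -
  define L where "L = frame_logic W R P"
  have "\<forall>p. p \<notin> L \<longrightarrow> (\<exists>V w. (\<forall>n. V n \<in> P) \<and> w \<in> W \<and> w \<notin> eval_fm (frame_alg W R) V p)"
  proof (intro allI impI)
    fix p assume "p \<notin> L"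
    then obtain V where V: "\<forall>n. V n \<in> P" "eval_fm (frame_alg W R) V p \<noteq> W"
      by (auto simp: L_def frame_logic_def logic_of_def valid_in_def)
    then have "eval_fm (frame_alg W R) V p \<in> P"
      using eval_closed[OF closed_alg_restrict[OF subalg], of V p] by simp
    then have "\<exists>w. w \<in> W \<and> w \<notin> eval_fm (frame_alg W R) V p" using P_subset[of "eval_fm (frame_alg W R) V p"] V(2) by auto
    with V(1) show "\<exists>V w. (\<forall>n. V n \<in> P) \<and> w \<in> W \<and> w \<notin> eval_fm (frame_alg W R) V p" by auto
  qed
  then obtain V w where Vw: "\<forall>p. p \<notin> L \<longrightarrow>
      (\<forall>n. V p n \<in> P) \<and> w p \<in> W \<and> w p \<notin> eval_fm (frame_alg W R) (V p) p" by metis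
  define agree where "agree p y y' \<longleftrightarrow> (\<forall>n\<in>atoms p. y \<in> V p n \<longleftrightarrow> y' \<in> V p n)" for p y y'
  have "\<forall>p. p \<notin> L \<longrightarrow> (\<exists>c z c' d e. (w p, c) \<in> R \<and> final_in R c \<and> (z, c') \<in> R \<and> final_in R c' \<and>
      (z, d) \<in> R \<and> final_in R d \<and> e \<in> P \<and> (\<forall>y. (c', y) \<in> R \<longrightarrow> y \<in> e) \<and> (\<forall>y. (d, y) \<in> R \<longrightarrow> y \<notin> e) \<and>
      (\<forall>y. (c, y) \<in> R \<longrightarrow> (\<exists>y'. (c', y') \<in> R \<and> agree p y y')) \<and>
      (\<forall>y'. (c', y') \<in> R \<longrightarrow> (\<exists>y. (c, y) \<in> R \<and> agree p y y')))"
    unfolding agree_def using Vw by (intro allI impI fork_over_color[OF fork]) simp_all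
  then obtain c z c' d e where data: "\<forall>p. p \<notin> L \<longrightarrow> (w p, c p) \<in> R \<and> final_in R (c p) \<and>
      (z p, c' p) \<in> R \<and> final_in R (c' p) \<and> (z p, d p) \<in> R \<and> final_in R (d p) \<and> e p \<in> P \<and>
      (\<forall>y. (c' p, y) \<in> R \<longrightarrow> y \<in> e p) \<and> (\<forall>y. (d p, y) \<in> R \<longrightarrow> y \<notin> e p) \<and>
      (\<forall>y. (c p, y) \<in> R \<longrightarrow> (\<exists>y'. (c' p, y') \<in> R \<and> agree p y y')) \<and>
      (\<forall>y'. (c' p, y') \<in> R \<longrightarrow> (\<exists>y. (c p, y) \<in> R \<and> agree p y y'))"
    by metis
  have wc: "(w p, c p) \<in> R" and zc': "(z p, c' p) \<in> R" and zd: "(z p, d p) \<in> R" and eP: "e p \<in> P"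
    and fc: "final_in R (c p)" and fc': "final_in R (c' p)" and VP: "V p n \<in> P"
    and c'_e: "(c' p, y) \<in> R \<Longrightarrow> y \<in> e p" and d_e: "(d p, y) \<in> R \<Longrightarrow> y \<notin> e p"
    and zig: "(c p, y) \<in> R \<Longrightarrow> \<exists>y'. (c' p, y') \<in> R \<and> agree p y y'"
    and zag: "(c' p, y) \<in> R \<Longrightarrow> \<exists>y'. (c p, y') \<in> R \<and> agree p y' y"
    if "p \<notin> L" for p n y
    using data Vw that by simp_all
  define I where "I = {i :: fm \<times> bool. fst i \<notin> L}"
  define root where "root i = (if snd i then z (fst i) else w (fst i))" for i :: "fm \<times> bool"
  define link1 where "link1 = {(((p, False), x), ((p, True), x')) |p x x'. p \<notin> L \<and>
    (c p, x) \<in> R \<and> (c' p, x') \<in> R \<and> agree p x x'}"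
  define link2 where "link2 = {(((p, True), x), ((q, True), x')) |p q x x'. p \<notin> L \<and> q \<notin> L \<and>
    (d p, x) \<in> R \<and> (d q, x') \<in> R}"
  define link where "link = link1 \<union> link1\<inverse> \<union> link2"
  have final: "(x, y) \<in> R" if "final_in R x0" "(x0, x) \<in> R" "(x0, y) \<in> R" for x0 x y
    using that R_trans by (auto simp: final_in_def)
  interpret G: gluing W R P root I link
  proof
    have "Bot \<notin> L"
      using P_closed(1) frame by (auto simp: L_def frame_logic_def logic_of_def valid_in_def
          general_S4_frame_def)
    then show "I \<noteq> {}" by (auto simp: I_def)
    show "root i \<in> W" if "i \<in> I" for i using that RW(1)[OF wc] RW(1)[OF zc'] by (auto simp: I_def root_def)
    show "(q, p) \<in> link" if "(p, q) \<in> link" for p q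
      using that by (auto simp: link_def link2_def)
    show "i \<in> I \<and> (root i, x) \<in> R" if l: "((i, x), q) \<in> link" for i x q
    proof -
      consider p where "p \<notin> L" "i = (p, False)" "(c p, x) \<in> R" | p where "p \<notin> L" "i = (p, True)" "(c' p, x) \<in> R"
        | p where "p \<notin> L" "i = (p, True)" "(d p, x) \<in> R"
        using l by (auto simp: link_def link1_def link2_def)
      then show ?thesis
      proof cases
        case (1 p)
        then show ?thesis using R_trans[OF wc 1(3)] by (simp add: I_def root_def)
      next
        case (2 p)
        then show ?thesis using R_trans[OF zc' 2(3)] by (simp add: I_def root_def)
      next
        case (3 p)
        then show ?thesis using R_trans[OF zd 3(3)] by (simp add: I_def root_def)
      qed
    qed
    show "\<exists>y'. (y, y') \<in> R \<and> ((i, x'), (j, y')) \<in> link"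
      if l: "((i, x), (j, y)) \<in> link" and xx': "(x, x') \<in> R" for i x j y x'
    proof -
      consider "((i, x), (j, y)) \<in> link1" | "((j, y), (i, x)) \<in> link1" | "((i, x), (j, y)) \<in> link2"
        using l by (auto simp: link_def)
      then show ?thesis
      proof cases
        case 1
        then obtain p where p: "p \<notin> L" "i = (p, False)" "j = (p, True)" "(c p, x) \<in> R" "(c' p, y) \<in> R"
          by (auto simp: link1_def)
        have cx': "(c p, x') \<in> R" using R_trans p(4) xx' by blast
        then obtain y' where y': "(c' p, y') \<in> R" "agree p x' y'" using zig[OF p(1)] by blast
        then have "(y, y') \<in> R" using final[OF fc'[OF p(1)] p(5)] by blast
        moreover have "((i, x'), (j, y')) \<in> link" using p y' cx' by (auto simp: link_def link1_def)
        ultimately show ?thesis by blast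
      next
        case 2
        then obtain p where p: "p \<notin> L" "j = (p, False)" "i = (p, True)" "(c p, y) \<in> R" "(c' p, x) \<in> R"
          by (auto simp: link1_def)
        have cx': "(c' p, x') \<in> R" using R_trans p(5) xx' by blast
        then obtain y' where y': "(c p, y') \<in> R" "agree p y' x'" using zag[OF p(1)] by blast
        then have "(y, y') \<in> R" using final[OF fc[OF p(1)] p(4)] by blast
        moreover have "((i, x'), (j, y')) \<in> link" using p y' cx' by (auto simp: link_def link1_def)
        ultimately show ?thesis by blast
      next
        case 3
        then obtain p q where pq: "p \<notin> L" "q \<notin> L" "i = (p, True)" "j = (q, True)" "(d p, x) \<in> R" "(d q, y) \<in> R"
          by (auto simp: link2_def)
        have "(d p, x') \<in> R" using R_trans pq(5) xx' by blast
        then have "((i, x'), (j, y)) \<in> link" using pq by (auto simp: link_def link2_def)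
        then show ?thesis using R_refl RW(2)[OF pq(6)] by blast
      qed
    qed
  qed
  have "p \<in> L" if p: "p \<in> frame_logic G.points G.access G.admissible" for p
  proof (rule ccontr)
    assume pL: "p \<notin> L"
    \<comment> \<open>The refuting valuation, continued to the component of the fork in such a way that it is
      compatible with the colours on the first cluster and, by cutting down to \<open>e p\<close>, empty on the
      cluster that belongs to the hub.\<close>
    define v where "v n = (if n \<in> atoms p then {((q, b), x). q = p \<and> ((q, b), x) \<in> G.points \<and>
      x \<in> V p n \<and> (b \<longrightarrow> x \<in> e p)} else {})" for n
    have vP: "v n \<in> G.admissible" for n
    proof (cases "n \<in> atoms p")
      case True
      have "\<exists>b\<in>P. G.slice i (v n) b" if i: "i \<in> I" for i
      proof -
        obtain q b where qb: "i = (q, b)" by (cases i)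
        consider "q \<noteq> p" | "q = p" "b" | "q = p" "\<not> b" by blast
        then show ?thesis
        proof cases
          case 1
          then show ?thesis using P_closed(1) True qb
            by (intro bexI[of _ "{}"]) (auto simp: v_def G.slice_def)
        next
          case 2
          then show ?thesis using P_closed(6)[OF VP eP, of p p n] pL True qb i
            by (intro bexI[of _ "V p n \<inter> e p"]) (auto simp: v_def G.slice_def G.points_def)
        next
          case 3
          then show ?thesis using VP[OF pL, of n] True qb i
            by (intro bexI[of _ "V p n"]) (auto simp: v_def G.slice_def G.points_def)
        qed
      qed
      moreover have "link `` v n \<subseteq> v n"
      proof
        fix q' assume "q' \<in> link `` v n"
        then obtain p' where p': "p' \<in> v n" "(p', q') \<in> link" by blast
        have points: "p' \<in> G.points" "q' \<in> G.points" using G.link_points p'(2) by auto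
        consider "(p', q') \<in> link1" | "(q', p') \<in> link1" | "(p', q') \<in> link2"
          using p'(2) by (auto simp: link_def)
        then show "q' \<in> v n"
        proof cases
          case 1
          then show ?thesis using p'(1) points True c'_e[OF pL] by (auto simp: v_def link1_def agree_def)
        next
          case 2
          then show ?thesis using p'(1) points True c'_e[OF pL] by (auto simp: v_def link1_def agree_def)
        next
          case 3
          then show ?thesis using p'(1) d_e[OF pL] by (auto simp: v_def link2_def split: if_splits)
        qed
      qed
      moreover have "v n \<subseteq> G.points" by (auto simp: v_def)
      ultimately show ?thesis by (simp add: G.admissible_def)
    qed (simp add: v_def G.admissible_closed(1))
    have i: "(p, False) \<in> I" using pL by (simp add: I_def)
    have "G.slice (p, False) (eval_fm (frame_alg G.points G.access) v p) (eval_fm (frame_alg W R) (V p) p)"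
      using vP i by (rule G.slice_eval) (auto simp: v_def G.slice_def G.points_def i)
    moreover have "w p \<notin> eval_fm (frame_alg W R) (V p) p" using Vw pL by blast
    ultimately have "((p, False), w p) \<notin> eval_fm (frame_alg G.points G.access) v p" by (simp add: G.slice_def)
    moreover have "((p, False), w p) \<in> G.points" using i R_refl Vw pL unfolding G.points_def by (simp add: root_def)
    moreover have "eval_fm (frame_alg G.points G.access) v p = G.points"
      using p vP by (simp add: frame_logic_def logic_of_def valid_in_def)
    ultimately show False by simp
  qed
  then have logic: "frame_logic G.points G.access G.admissible = L" using G.glued_logic by (auto simp: L_def)
  have "path_connected_frame G.points G.access"
  proof -
    let ?T = "(G.access \<union> G.access\<inverse>)\<^sup>*"
    have sym: "(q, p) \<in> ?T" if "(p, q) \<in> ?T" for p q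
      using that by (metis converse_Un converse_converse rtrancl_converseI sup_commute)
    have tr: "(p, r) \<in> ?T" if "(p, q) \<in> ?T" "(q, r) \<in> ?T" for p q r
      using that by (rule rtrancl_trans)
    have access: "(p, q) \<in> ?T" if "(p, q) \<in> G.access" for p q using that by blast
    have from_root: "((i, root i), (i, x)) \<in> G.step" if "(i, x) \<in> G.points" for i x
      using that R_refl RW by (auto simp: G.step_def G.points_def)
    have link_T: "((i, root i), q) \<in> ?T" if "((i, x), q) \<in> link" for i x q
    proof -
      have "((i, root i), (i, x)) \<in> G.step" using from_root that G.link_points by blast
      then show ?thesis using that G.step_link_access access by blast
    qed
    have to_root: "((p, b), x) \<in> G.points \<Longrightarrow> (((p, b), root (p, b)), ((p, b), x)) \<in> ?T" for p b x
      using from_root G.step_subset_access access by blast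
    have hub: "(((p, b), x), ((p, True), d p)) \<in> ?T" if points: "((p, b), x) \<in> G.points" for p b x
    proof -
      have pL: "p \<notin> L" using points unfolding G.points_def by (auto simp: I_def)
      have "(c p, c p) \<in> R" using R_refl RW(2)[OF wc[OF pL]] .
      then obtain y' where "(c' p, y') \<in> R" "agree p (c p) y'" using zig[OF pL] by blast
      then have l: "(((p, False), c p), ((p, True), y')) \<in> link"
        using pL \<open>(c p, c p) \<in> R\<close> by (auto simp: link_def link1_def)
      have 1: "(((p, True), root (p, True)), ((p, True), y')) \<in> ?T"
        using to_root G.link_points[OF l] by blast
      have 2: "(((p, False), root (p, False)), ((p, True), y')) \<in> ?T" using link_T[OF l] .
      have "((p, True), d p) \<in> G.points" using zd[OF pL] pL unfolding G.points_def by (simp add: I_def root_def)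
      then have 3: "(((p, True), root (p, True)), ((p, True), d p)) \<in> ?T" using to_root by blast
      have "(((p, b), root (p, b)), ((p, True), d p)) \<in> ?T"
        using 3 tr[OF 2 tr[OF sym[OF 1] 3]] by (cases b) simp_all
      then show ?thesis by (rule tr[OF sym[OF to_root[OF points]]])
    qed
    have hubs: "(((p, True), d p), ((q, True), d q)) \<in> ?T" if pq: "p \<notin> L" "q \<notin> L" for p q
    proof -
      have "(d p, d p) \<in> R" "(d q, d q) \<in> R"
        using R_refl RW(2)[OF zd[OF pq(1)]] RW(2)[OF zd[OF pq(2)]] by blast+
      then have l: "(((p, True), d p), ((q, True), d q)) \<in> link"
        using pq by (auto simp: link_def link2_def)
      have "(((p, True), root (p, True)), ((p, True), d p)) \<in> ?T" using to_root G.link_points[OF l] by blast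
      then show ?thesis using tr[OF sym link_T[OF l]] by blast
    qed
    show ?thesis
      unfolding path_connected_frame_def
    proof (intro ballI)
      fix u v assume u: "u \<in> G.points" and v: "v \<in> G.points"
      obtain p b x where u': "u = ((p, b), x)" by (metis surj_pair)
      obtain q b' y where v': "v = ((q, b'), y)" by (metis surj_pair)
      have "p \<notin> L" "q \<notin> L" using u v unfolding u' v' G.points_def by (auto simp: I_def)
      then have "(((p, True), d p), ((q, True), d q)) \<in> ?T" by (rule hubs)
      then show "(u, v) \<in> ?T"
        using tr[OF hub[OF u[unfolded u']] tr[OF _ sym[OF hub[OF v[unfolded v']]]]] unfolding u' v' by blast
    qed
  qed
  from countable_frame_transfer[OF G.glued_frame this]
  show ?thesis unfolding logic L_def .
qed

end

lemma connected_logic_imp_frame: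
  assumes "connected_logic TYPE('a) L"
  shows "logic_of_countable_path_connected_frame TYPE('b::infinite) L"
proof -
  obtain A :: "'a modal_alg" where A: "closure_algebra A" "connected_alg A" "L = logic_of A"
    using assms by (auto simp: connected_logic_def)
  obtain W :: "'a set set" and R P where F: "general_S4_frame W R P" "frame_logic W R P = logic_of A"
    "connected_alg (frame_sub W R P)" "tight W R P"
    "\<forall>x\<in>W. \<exists>d. (x, d) \<in> R \<and> final_in R d"
    by (rule ultrafilter_frame[OF A(1,2)])
  interpret connected_frame W R P by unfold_locales (use F in auto)
  show ?thesis
  proof (cases "\<exists>z d1 d2. (z, d1) \<in> R \<and> (z, d2) \<in> R \<and> final_in R d1 \<and> final_in R d2 \<and> (d2, d1) \<notin> R")
    case True
    then show ?thesis using glue_refutations A(3) F(2) by metis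
  next
    case False
    then have "path_connected_frame W R" by (intro path_connected_no_fork) blast
    then show ?thesis using countable_frame_transfer[OF F(1)] A(3) F(2) by metis
  qed
qed

section \<open>The Alexandrov topology of a frame\<close>

definition upset_topology :: "'a set \<Rightarrow> 'a rel \<Rightarrow> 'a topology" where
  "upset_topology W R = topology (\<lambda>U. U \<subseteq> W \<and> R `` U \<subseteq> U)"

lemma openin_upset_topology [simp]: "openin (upset_topology W R) U \<longleftrightarrow> U \<subseteq> W \<and> R `` U \<subseteq> U"
proof -
  have "istopology (\<lambda>U. U \<subseteq> W \<and> R `` U \<subseteq> U)"
    unfolding istopology_def by blast
  then show ?thesis by (simp add: upset_topology_def topology_inverse')
qed

lemma topspace_upset_topology [simp]:
  assumes "R \<subseteq> W \<times> W"
  shows "topspace (upset_topology W R) = W"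
  using assms by (auto simp: topspace_def)

text \<open>The smallest open set around \<open>x\<close> is \<open>R `` {x}\<close>, so closure is the preimage operator.\<close>
lemma space_alg_upset_topology:
  assumes "preorder_on W R"
  shows "space_alg (upset_topology W R) = frame_alg W R"
proof -
  have RW: "R \<subseteq> W \<times> W" and refl: "\<And>x. x \<in> W \<Longrightarrow> (x, x) \<in> R" and tr: "trans R"
    using assms by (auto simp: preorder_on_def refl_on_def)
  have "x \<in> upset_topology W R closure_of a \<longleftrightarrow> x \<in> R\<inverse> `` a" for x a
  proof
    assume x: "x \<in> upset_topology W R closure_of a"
    then have "x \<in> W" using RW by (simp add: in_closure_of)
    moreover have "openin (upset_topology W R) (R `` {x})"
      unfolding openin_upset_topology using RW tr by (auto dest: transD)
    moreover have "x \<in> R `` {x}" using refl \<open>x \<in> W\<close> by blast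
    ultimately have "\<exists>y. y \<in> a \<and> y \<in> R `` {x}"
      using x[unfolded in_closure_of, THEN conjunct2, THEN spec, of "R `` {x}"] by blast
    then show "x \<in> R\<inverse> `` a" by blast
  next
    assume "x \<in> R\<inverse> `` a"
    then obtain y where "(x, y) \<in> R" "y \<in> a" by blast
    then show "x \<in> upset_topology W R closure_of a"
      unfolding in_closure_of topspace_upset_topology[OF RW] openin_upset_topology using RW by blast
  qed
  then have "(\<lambda>a. upset_topology W R closure_of a) = (\<lambda>a. R\<inverse> `` a)" by blast
  then show ?thesis using RW by (simp add: space_alg_def frame_alg_def)
qed

lemma connected_upset_topology:
  assumes "preorder_on W R" "path_connected_frame W R"
  shows "connected_space (upset_topology W R)"
  unfolding connected_space_clopen_in
proof (intro allI impI)
  have RW: "R \<subseteq> W \<times> W" using assms by (auto simp: preorder_on_def)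
  fix U assume "openin (upset_topology W R) U \<and> closedin (upset_topology W R) U"
  then have U: "U \<subseteq> W" "R `` U \<subseteq> U" "R `` (W - U) \<subseteq> W - U"
    using RW by (simp_all add: closedin_def)
  have "y \<in> U" if "(x, y) \<in> (R \<union> R\<inverse>)\<^sup>*" "x \<in> U" for x y
    using that by (induction rule: rtrancl_induct) (use U RW in blast)+
  then show "U = {} \<or> U = topspace (upset_topology W R)"
    using assms(2) U(1) RW unfolding path_connected_frame_def by (simp add: subset_iff) blast
qed

lemma frame_imp_connected_space:
  assumes "logic_of_countable_path_connected_frame TYPE('a) L"
  shows "logic_of_countable_connected_space TYPE('a) L"
proof -
  obtain W :: "'a set" and R P where F: "general_S4_frame W R P" "countable W" "path_connected_frame W R"
    "L = frame_logic W R P"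
    using assms by (auto simp: logic_of_countable_path_connected_frame_def)
  have pre: "preorder_on W R" using F(1) by (simp add: general_S4_frame_def)
  then have W: "topspace (upset_topology W R) = W" by (simp add: preorder_on_def)
  have "general_space (upset_topology W R) P" "L = space_logic (upset_topology W R) P"
    using F W space_alg_upset_topology[OF pre]
    by (simp_all add: general_space_def general_S4_frame_def space_logic_def frame_logic_def)
  then show ?thesis
    unfolding logic_of_countable_connected_space_def
    using F(2) W connected_upset_topology[OF pre F(3)] by metis
qed

section \<open>A nonprincipal ultrafilter on the natural numbers\<close>

lemma nonprincipal_ultrafilter:
  obtains U :: "nat set set" where
    "\<And>A. - A \<in> U \<longleftrightarrow> A \<notin> U" "\<And>A B. A \<inter> B \<in> U \<longleftrightarrow> A \<in> U \<and> B \<in> U"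
    "\<And>A B. A \<union> B \<in> U \<longleftrightarrow> A \<in> U \<or> B \<in> U" "\<And>n. {n..} \<in> U" "{} \<notin> U" "UNIV \<in> U"
proof -
  let ?A = "powerset_alg (UNIV :: nat set) (\<lambda>U. U)"
  have "boolean_alg ?A" by (rule boolean_alg_set_alg[of _ UNIV]) (auto simp: powerset_alg_def)
  then interpret carrier_boolean_algebra ?A by unfold_locales
  obtain U where U: "U \<in> ultrafilters ?A" "range (\<lambda>n::nat. {n..}) \<subseteq> U"
  proof (rule ultrafilter_exists[of "range (\<lambda>n::nat. {n..})"])
    show "meet ?A a b \<in> range (\<lambda>n. {n..})" if ab: "a \<in> range (\<lambda>n. {n..})" "b \<in> range (\<lambda>n. {n..})" for a b
    proof -
      obtain m n where "a = {m..}" "b = {n..}" using ab by blast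
      then have "meet ?A a b = {max m n..}" by (auto simp: powerset_alg_def)
      then show ?thesis by blast
    qed
  qed (auto simp: powerset_alg_def)
  show ?thesis
    by (rule that[of U])
      (use U(2) ultrafiltersD[OF U(1)] in \<open>auto simp: powerset_alg_def Compl_eq_Diff_UNIV\<close>)
qed

section \<open>From frames to the real line\<close>

text \<open>Concatenate paths between consecutive points of an enumeration of \<open>W\<close>.\<close>
lemma zigzag_sequence:
  assumes "countable W" "W \<noteq> {}" "path_connected_frame W R" "R \<subseteq> W \<times> W" "\<And>x. x \<in> W \<Longrightarrow> (x, x) \<in> R"
  obtains u :: "int \<Rightarrow> 'a" where "range u = W" "\<And>k. (u k, u (k + 1)) \<in> R \<or> (u (k + 1), u k) \<in> R"
proof -
  define T where "T = R \<union> R\<inverse>"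
  define e where "e = from_nat_into W"
  have e: "range e = W" using assms(1,2) by (simp add: e_def range_from_nat_into)
  have "\<exists>l g. g 0 = e n \<and> g l = e (Suc n) \<and> (\<forall>i<l. (g i, g (Suc i)) \<in> T)" for n
  proof -
    have "e n \<in> W" "e (Suc n) \<in> W" using e by auto
    then have "(e n, e (Suc n)) \<in> T\<^sup>*" using assms(3) by (simp add: path_connected_frame_def T_def)
    then obtain l where "(e n, e (Suc n)) \<in> T ^^ l" using rtrancl_imp_relpow by blast
    then show ?thesis unfolding relpow_fun_conv by blast
  qed
  then obtain l :: "nat \<Rightarrow> nat" and g where g: "\<And>n. g n 0 = e n" "\<And>n. g n (l n) = e (Suc n)"
    "\<And>n i. i < l n \<Longrightarrow> (g n i, g n (Suc i)) \<in> T" by metis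
  \<comment> \<open>The state \<open>(n, i)\<close> stands for position \<open>i\<close> on the \<open>n\<close>-th path.\<close>
  define st where "st = rec_nat (0, 0) (\<lambda>_ s. if snd s < l (fst s) then (fst s, Suc (snd s)) else (Suc (fst s), 0))"
  have st0: "st 0 = (0, 0)" and st_Suc: "st (Suc m) = (if snd (st m) < l (fst (st m))
      then (fst (st m), Suc (snd (st m))) else (Suc (fst (st m)), 0))" for m
    by (simp_all add: st_def)
  define s where "s m = g (fst (st m)) (snd (st m))" for m
  have inv: "snd (st m) \<le> l (fst (st m))" for m
    by (induction m) (auto simp: st0 st_Suc)
  have edge: "(s m, s (Suc m)) \<in> T \<or> s m = s (Suc m)" for m
  proof (cases "snd (st m) < l (fst (st m))")
    case True
    then show ?thesis using g(3) by (simp add: s_def st_Suc)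
  next
    case False
    then have "snd (st m) = l (fst (st m))" using inv[of m] by simp
    then show ?thesis using g(1,2) by (simp add: s_def st_Suc)
  qed
  have "T \<subseteq> W \<times> W" using assms(4) by (auto simp: T_def)
  then have sW: "s m \<in> W" for m
  proof (induction m)
    case 0
    then show ?case using e g(1) by (auto simp: s_def st0)
  next
    case (Suc m)
    then show ?case using edge[of m] by auto
  qed
  have "\<exists>m. st m = (n, 0)" for n
  proof (induction n)
    case (Suc n)
    then obtain m where m: "st m = (n, 0)" by blast
    have "i \<le> l n \<Longrightarrow> st (m + i) = (n, i)" for i
      by (induction i) (auto simp: m st_Suc)
    then have "st (Suc (m + l n)) = (Suc n, 0)" by (simp add: st_Suc)
    then show ?case by blast
  qed (use st0 in blast)
  then have "e n \<in> range s" for n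
  proof -
    obtain m where "st m = (n, 0)" using \<open>\<And>n. \<exists>m. st m = (n, 0)\<close> by blast
    then have "s m = e n" using g(1) by (simp add: s_def)
    then show ?thesis by (metis rangeI)
  qed
  then have range: "range s = W" using e sW by blast
  show ?thesis
  proof (rule that[of "\<lambda>k. s (nat k)"])
    have "range (\<lambda>k. s (nat k)) = s ` range nat" by (simp add: image_image)
    moreover have "range nat = UNIV" by (metis nat_int surj_def)
    ultimately show "range (\<lambda>k. s (nat k)) = W" using range by simp
    show "(s (nat k), s (nat (k + 1))) \<in> R \<or> (s (nat (k + 1)), s (nat k)) \<in> R" for k
    proof (cases "k < 0")
      case True
      then show ?thesis using assms(5) sW by simp
    next
      case False
      then have "nat (k + 1) = Suc (nat k)" by simp
      then show ?thesis using edge[of "nat k"] assms(5) sW by (auto simp: T_def)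
    qed
  qed
qed

text \<open>The sequence \<open>u\<close> supplies the labels of stage 0, and \<open>choice w n\<close> is the point above \<open>w\<close> that is
  inserted at stage \<open>n\<close> into cells labelled \<open>w\<close>; every point above \<open>w\<close> is chosen infinitely often.\<close>
locale line_labelling =
  fixes W :: "'a set" and R :: "'a rel" and u :: "int \<Rightarrow> 'a" and choice :: "'a \<Rightarrow> nat \<Rightarrow> 'a"
  assumes preorder: "preorder_on W R"
    and u_range: "range u = W"
    and u_edge: "(u k, u (k + 1)) \<in> R \<or> (u (k + 1), u k) \<in> R"
    and choice: "w \<in> W \<Longrightarrow> (w, choice w n) \<in> R"
    and choice_often: "(w, v) \<in> R \<Longrightarrow> \<exists>m\<ge>n. choice w m = v"
begin

lemma RW: "(x, y) \<in> R \<Longrightarrow> y \<in> W" and R_refl: "x \<in> W \<Longrightarrow> (x, x) \<in> R"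
  and R_trans: "(x, y) \<in> R \<Longrightarrow> (y, z) \<in> R \<Longrightarrow> (x, z) \<in> R"
  using preorder by (auto simp: preorder_on_def refl_on_def dest: transD)

text \<open>\<open>cell_label n k\<close> is the label at stage \<open>n\<close> of the open interval between \<open>k / 3 ^ n\<close> and
  \<open>(k + 1) / 3 ^ n\<close>. The outer thirds of a cell inherit its label and the middle third moves upwards.\<close>
primrec cell_label :: "nat \<Rightarrow> int \<Rightarrow> 'a" where
  "cell_label 0 k = u k"
| "cell_label (Suc n) k = (if k mod 3 = 1 then choice (cell_label n (k div 3)) n else cell_label n (k div 3))"

text \<open>At stage 0 an integer carries the lower one of the labels of its two neighbouring cells, so that
  continuity holds there. A division point that is not an integer keeps the label it had as an
  inner point of a cell; this label is below those of the cells that it separates.\<close>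
primrec point_label :: "nat \<Rightarrow> real \<Rightarrow> 'a" where
  "point_label 0 x = (if x \<in> \<int> \<and> (u (\<lfloor>x\<rfloor> - 1), u \<lfloor>x\<rfloor>) \<in> R then u (\<lfloor>x\<rfloor> - 1) else u \<lfloor>x\<rfloor>)"
| "point_label (Suc n) x = (if 3 ^ Suc n * x \<in> \<int> then point_label n x else cell_label (Suc n) \<lfloor>3 ^ Suc n * x\<rfloor>)"

lemma u_in: "u k \<in> W"
  using u_range by blast

lemma cell_label_in: "cell_label n k \<in> W"
  by (induction n arbitrary: k) (simp_all add: u_in RW[OF choice])

lemma cell_label_step: "(cell_label n (k div 3), cell_label (Suc n) k) \<in> R"
  using choice cell_label_in R_refl by simp

lemma grid_Suc: "3 ^ n * x \<in> \<int> \<Longrightarrow> 3 ^ Suc n * x \<in> \<int>" for x :: real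
  using Ints_mult[of 3 "3 ^ n * x"] by (simp add: mult.assoc)

lemma point_label_off_grid: "3 ^ n * x \<notin> \<int> \<Longrightarrow> point_label n x = cell_label n \<lfloor>3 ^ n * x\<rfloor>"
  by (cases n) auto

lemma floor_parent: "\<lfloor>3 ^ n * x\<rfloor> = \<lfloor>3 ^ Suc n * x\<rfloor> div 3" for x :: real
  using floor_divide_real_eq_div[of 3 "3 ^ Suc n * x"] by simp

lemma point_label_in: "point_label n x \<in> W"
  by (induction n) (simp_all add: u_in cell_label_in del: cell_label.simps)

lemma point_label_step: "(point_label n x, point_label (Suc n) x) \<in> R"
proof (cases "3 ^ Suc n * x \<in> \<int>")
  case True
  then show ?thesis using R_refl point_label_in by simp
next
  case False
  then have "point_label n x = cell_label n (\<lfloor>3 ^ Suc n * x\<rfloor> div 3)"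
    using point_label_off_grid grid_Suc floor_parent by metis
  then show ?thesis using point_label_off_grid[OF False] cell_label_step by metis
qed

lemma point_label_mono: "m \<le> n \<Longrightarrow> (point_label m x, point_label n x) \<in> R"
  by (induction rule: dec_induct) (use R_refl point_label_in point_label_step R_trans in blast)+

lemma same_cell_nearby:
  fixes x :: real
  assumes "3 ^ n * x \<notin> \<int>"
  shows "\<exists>\<epsilon>>0. \<forall>y. \<bar>y - x\<bar> < \<epsilon> \<longrightarrow> 3 ^ n * y \<notin> \<int> \<and> \<lfloor>3 ^ n * y\<rfloor> = \<lfloor>3 ^ n * x\<rfloor>"
proof -
  define t where "t = 3 ^ n * x"
  define k where "k = \<lfloor>t\<rfloor>"
  have "real_of_int k \<noteq> t" using assms unfolding t_def by (metis Ints_of_int)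
  then have k: "real_of_int k < t" "t < real_of_int k + 1" unfolding k_def by linarith+
  define \<delta> where "\<delta> = min (t - k) (k + 1 - t)"
  have "\<delta> > 0" using k by (simp add: \<delta>_def)
  show ?thesis
  proof (intro exI[of _ "\<delta> / 3 ^ n"] conjI allI impI)
    show "\<delta> / 3 ^ n > 0" using \<open>\<delta> > 0\<close> by simp
    fix y assume "\<bar>y - x\<bar> < \<delta> / 3 ^ n"
    then have "3 ^ n * \<bar>y - x\<bar> < \<delta>" by (simp add: field_simps)
    then have "\<bar>3 ^ n * y - t\<bar> < \<delta>"
      unfolding t_def right_diff_distrib[symmetric] abs_mult by simp
    then have y: "real_of_int k < 3 ^ n * y" "3 ^ n * y < real_of_int k + 1"
      unfolding \<delta>_def by linarith+
    then have "\<lfloor>3 ^ n * y\<rfloor> = k" by linarith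
    then show "\<lfloor>3 ^ n * y\<rfloor> = \<lfloor>3 ^ n * x\<rfloor>" by (simp add: k_def t_def)
    show "3 ^ n * y \<notin> \<int>"
      using y(1) \<open>\<lfloor>3 ^ n * y\<rfloor> = k\<close> by (metis floor_of_int Ints_cases order_less_irrefl)
  qed
qed

text \<open>Continuity with respect to the topology of upward closed sets on \<open>W\<close>. At a point that is not a
  division point the label is locally constant; at a division point the label does not change any more
  whereas the labels around it move upwards.\<close>
lemma point_label_continuous: "\<exists>\<epsilon>>0. \<forall>y. \<bar>y - x\<bar> < \<epsilon> \<longrightarrow> (point_label n x, point_label n y) \<in> R"
proof (cases "3 ^ n * x \<in> \<int>")
  case False
  then show ?thesis
    using same_cell_nearby[OF False] point_label_off_grid R_refl point_label_in by metis
next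
  case True
  then show ?thesis
  proof (induction n)
    case 0
    then obtain k where k: "x = real_of_int k" by (auto elim: Ints_cases)
    have "(point_label 0 x, point_label 0 y) \<in> R" if y: "\<bar>y - x\<bar> < 1" for y
    proof -
      consider "y = x" | "y > x" "\<lfloor>y\<rfloor> = k" | "y < x" "\<lfloor>y\<rfloor> = k - 1"
        using y k by linarith
      then show ?thesis
      proof cases
        case 1
        then show ?thesis using R_refl point_label_in by blast
      next
        case 2
        then have "y \<notin> \<int>" using k by (auto elim!: Ints_cases)
        then show ?thesis using 2 k R_refl u_in by auto
      next
        case 3
        then have "y \<notin> \<int>" using k y by (auto elim!: Ints_cases)
        then show ?thesis using 3 k R_refl u_in u_edge[of "k - 1"] by auto
      qed
    qed
    then show ?case by (intro exI[of _ 1]) simp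
  next
    case (Suc n)
    have point_label: "point_label (Suc n) x = point_label n x" using Suc.prems by simp
    have "\<exists>\<epsilon>>0. \<forall>y. \<bar>y - x\<bar> < \<epsilon> \<longrightarrow> (point_label n x, point_label n y) \<in> R"
    proof (cases "3 ^ n * x \<in> \<int>")
      case False
      then show ?thesis
        using same_cell_nearby[OF False] point_label_off_grid R_refl point_label_in by metis
    qed (rule Suc.IH)
    then show ?case unfolding point_label using point_label_step R_trans by metis
  qed
qed

lemma point_label_on_grid:
  assumes "3 ^ n * x \<in> \<int>" "n \<le> m"
  shows "point_label m x = point_label n x"
proof -
  have "3 ^ m * x \<in> \<int> \<and> point_label m x = point_label n x"
    using assms(2)
  proof (induction rule: dec_induct)
    case (step m)
    then show ?case using grid_Suc[of m x] by simp
  qed (use assms(1) in simp)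
  then show ?thesis ..
qed

text \<open>When a division point appears, one of the two cells next to it is an outer third and has the label of
  the parent cell, which the point keeps. From then on both cells next to the point are outer thirds,
  so the label persists in that direction. At stage 0 the claim holds by the choice of the label.\<close>
lemma point_label_adjacent:
  assumes "3 ^ n * x = real_of_int k"
  shows "cell_label n k = point_label n x \<or> cell_label n (k - 1) = point_label n x"
  using assms
proof (induction n arbitrary: k)
  case 0
  then show ?case by auto
next
  case (Suc n)
  then have point_label: "point_label (Suc n) x = point_label n x" by (metis Ints_of_int point_label.simps(2))
  have x: "3 ^ n * x = real_of_int k / 3" using Suc.prems by simp
  have "\<exists>j. k = 3 * j \<or> k = 3 * j + 1 \<or> k = 3 * j + 2" by presburger
  then consider j where "k = 3 * j" | j where "k = 3 * j + 1" | j where "k = 3 * j + 2" by blast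
  then show ?case
  proof cases
    case (1 j)
    then have "3 ^ n * x = real_of_int j" using x by simp
    then have "cell_label n j = point_label n x \<or> cell_label n (j - 1) = point_label n x" by (rule Suc.IH)
    moreover have "cell_label (Suc n) k = cell_label n j" "cell_label (Suc n) (k - 1) = cell_label n (j - 1)"
    proof -
      show "cell_label (Suc n) k = cell_label n j" using 1 by simp
      have "k - 1 = 3 * (j - 1) + 2" using 1 by simp
      then have "(k - 1) mod 3 = 2" "(k - 1) div 3 = j - 1" by presburger+
      then show "cell_label (Suc n) (k - 1) = cell_label n (j - 1)" by simp
    qed
    ultimately show ?thesis using point_label by simp
  next
    case (2 j)
    have fl: "\<lfloor>3 ^ n * x\<rfloor> = j" using x 2 by simp linarith
    have "3 ^ n * x \<notin> \<int>"
    proof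
      assume "3 ^ n * x \<in> \<int>"
      then have "3 ^ n * x = real_of_int j" using fl by (metis floor_of_int Ints_cases)
      then show False using x 2 by simp
    qed
    then have "point_label n x = cell_label n j" using point_label_off_grid fl by simp
    moreover have "cell_label (Suc n) (k - 1) = cell_label n j" using 2 by simp
    ultimately show ?thesis using point_label by simp
  next
    case (3 j)
    have fl: "\<lfloor>3 ^ n * x\<rfloor> = j" using x 3 by simp linarith
    have "3 ^ n * x \<notin> \<int>"
    proof
      assume "3 ^ n * x \<in> \<int>"
      then have "3 ^ n * x = real_of_int j" using fl by (metis floor_of_int Ints_cases)
      then show False using x 3 by simp
    qed
    then have "point_label n x = cell_label n j" using point_label_off_grid fl by simp
    moreover have "k mod 3 = 2" "k div 3 = j" using 3 by presburger+
    then have "cell_label (Suc n) k = cell_label n j" by simp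
    ultimately show ?thesis using point_label by simp
  qed
qed

text \<open>Outer thirds inherit labels, so cells arbitrarily close to either end of a cell carry its label.\<close>
lemma cell_label_left_end: "cell_label (n + j) (3 ^ j * k) = cell_label n k"
  by (induction j) (simp_all add: mult.assoc)

lemma cell_label_right_end: "cell_label (n + j) (3 ^ j * (k + 1) - 1) = cell_label n k"
proof (induction j)
  case (Suc j)
  define q where "q = 3 ^ j * (k + 1) - 1"
  have "3 ^ Suc j * (k + 1) - 1 = 3 * q + 2" by (simp add: q_def)
  moreover have "(3 * q + 2) mod 3 = 2" "(3 * q + 2) div 3 = q" by presburger+
  ultimately have "cell_label (n + Suc j) (3 ^ Suc j * (k + 1) - 1) = cell_label (n + j) q" by simp
  then show ?case using Suc by (simp add: q_def)
qed simp

text \<open>The number \<open>(q + 4/9) / 3 ^ m\<close> lies inside the middle third of cell \<open>q\<close> and is a division point one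
  stage later; its label is frozen immediately after the middle third has received \<open>v\<close>.\<close>
lemma point_label_center:
  assumes "choice (cell_label m q) m = v" "i \<ge> Suc m"
  shows "point_label i ((real_of_int q + 4/9) / 3 ^ m) = v"
proof -
  define y where "y = (real_of_int q + 4/9) / 3 ^ m"
  have 1: "3 ^ Suc m * y = real_of_int (3 * q + 1) + 1/3"
    by (simp add: y_def field_simps)
  then have fl: "\<lfloor>3 ^ Suc m * y\<rfloor> = 3 * q + 1" by linarith
  have "3 ^ Suc m * y \<notin> \<int>"
  proof
    assume "3 ^ Suc m * y \<in> \<int>"
    then have "3 ^ Suc m * y = real_of_int (3 * q + 1)" using fl by (metis floor_of_int Ints_cases)
    then show False using 1 by simp
  qed
  then have "point_label (Suc m) y = cell_label (Suc m) (3 * q + 1)" using point_label_off_grid[of "Suc m" y] fl by metis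
  moreover have "(3 * q + 1) mod 3 = 1" "(3 * q + 1) div 3 = q" by presburger+
  ultimately have v: "point_label (Suc m) y = v" using assms(1) by simp
  have "3 ^ Suc (Suc m) * y = real_of_int (9 * q + 4)" by (simp add: y_def field_simps)
  then have grid: "3 ^ Suc (Suc m) * y \<in> \<int>" by (metis Ints_of_int)
  then have "point_label (Suc (Suc m)) y = v" using v by simp
  moreover have "i = Suc m \<or> i \<ge> Suc (Suc m)" using assms(2) by linarith
  ultimately show ?thesis using v point_label_on_grid[OF grid] unfolding y_def by metis
qed

text \<open>Wait for a late stage at which \<open>v\<close> is chosen, and use the cell at the left or right end of cell \<open>k\<close>,
  which still carries the old label.\<close>
lemma realize_near:
  assumes "(cell_label n k, v) \<in> R"
  shows "\<exists>y m. \<bar>y - real_of_int k / 3 ^ n\<bar> < 1 / 3 ^ N \<and> (\<forall>i\<ge>m. point_label i y = v)"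
    and "\<exists>y m. \<bar>y - real_of_int (k + 1) / 3 ^ n\<bar> < 1 / 3 ^ N \<and> (\<forall>i\<ge>m. point_label i y = v)"
proof -
  obtain m where m: "m \<ge> max n N" "choice (cell_label n k) m = v" using choice_often[OF assms] by blast
  define j where "j = m - n"
  have mj: "m = n + j" using m(1) by (simp add: j_def)
  have small: "1 / (3::real) ^ m \<le> 1 / 3 ^ N" using m(1) by (simp add: field_simps)
  have pos: "1 / (3::real) ^ m > 0" by simp
  define y where "y = (real_of_int (3 ^ j * k) + 4/9) / 3 ^ m"
  have "y - real_of_int k / 3 ^ n = 4/9 * (1 / 3 ^ m)"
    by (simp add: y_def mj power_add field_simps)
  then have "\<bar>y - real_of_int k / 3 ^ n\<bar> < 1 / 3 ^ N" using small pos by linarith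
  moreover have "\<forall>i\<ge>Suc m. point_label i y = v"
    unfolding y_def using m(2) cell_label_left_end[of n j k] mj by (intro allI impI point_label_center) simp_all
  ultimately show "\<exists>y m. \<bar>y - real_of_int k / 3 ^ n\<bar> < 1 / 3 ^ N \<and> (\<forall>i\<ge>m. point_label i y = v)" by blast
  define z where "z = (real_of_int (3 ^ j * (k + 1) - 1) + 4/9) / 3 ^ m"
  have "z - real_of_int (k + 1) / 3 ^ n = - (5/9 * (1 / 3 ^ m))"
    by (simp add: z_def mj power_add field_simps)
  then have "\<bar>z - real_of_int (k + 1) / 3 ^ n\<bar> < 1 / 3 ^ N" using small pos by linarith
  moreover have "\<forall>i\<ge>Suc m. point_label i z = v"
    unfolding z_def using m(2) cell_label_right_end[of n j k] mj by (intro allI impI point_label_center) simp_all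
  ultimately show "\<exists>y m. \<bar>y - real_of_int (k + 1) / 3 ^ n\<bar> < 1 / 3 ^ N \<and> (\<forall>i\<ge>m. point_label i y = v)" by blast
qed

text \<open>If \<open>x\<close> is a division point, its label is fixed and shared by an adjacent cell, so \<open>v\<close> is realised in
  that cell next to \<open>x\<close>. Otherwise \<open>x\<close> lies in cells of arbitrarily small length carrying its label,
  and \<open>v\<close> may depend on the stage.\<close>
lemma point_label_open:
  assumes a: "\<And>n. point_label n x \<in> R\<inverse> `` a" and \<epsilon>: "\<epsilon> > 0"
  shows "\<exists>y v m. \<bar>y - x\<bar> < \<epsilon> \<and> v \<in> a \<and> (\<forall>i\<ge>m. point_label i y = v)"
proof -
  obtain N :: nat where "2 / \<epsilon> < 3 ^ N" using real_arch_pow[of 3 "2 / \<epsilon>"] by auto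
  then have N: "2 * (1 / 3 ^ N) < \<epsilon>" using \<epsilon> by (simp add: field_simps)
  have pos: "1 / (3::real) ^ N > 0" by simp
  show ?thesis
  proof (cases "\<exists>n. 3 ^ n * x \<in> \<int>")
    case True
    then obtain n k where k: "3 ^ n * x = real_of_int k" by (auto elim: Ints_cases)
    then have x: "x = real_of_int k / 3 ^ n" by (simp add: field_simps)
    obtain v where v: "v \<in> a" "(point_label n x, v) \<in> R" using a by blast
    from point_label_adjacent[OF k] have "\<exists>y m. \<bar>y - x\<bar> < 1 / 3 ^ N \<and> (\<forall>i\<ge>m. point_label i y = v)"
    proof
      assume "cell_label n k = point_label n x"
      then show ?thesis using realize_near(1)[of n k v N] v(2) unfolding x by simp
    next
      assume "cell_label n (k - 1) = point_label n x"
      then show ?thesis using realize_near(2)[of n "k - 1" v N] v(2) unfolding x by simp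
    qed
    then obtain y m where "\<bar>y - x\<bar> < 1 / 3 ^ N" "\<forall>i\<ge>m. point_label i y = v" by blast
    moreover from this have "\<bar>y - x\<bar> < \<epsilon>" using N pos by linarith
    ultimately show ?thesis using v(1) by blast
  next
    case False
    define k where "k = \<lfloor>3 ^ N * x\<rfloor>"
    have "point_label N x = cell_label N k" using point_label_off_grid False by (simp add: k_def)
    moreover obtain v where v: "v \<in> a" "(point_label N x, v) \<in> R" using a by blast
    ultimately obtain y m where y: "\<bar>y - real_of_int k / 3 ^ N\<bar> < 1 / 3 ^ N" "\<forall>i\<ge>m. point_label i y = v"
      using realize_near(1)[of N k v N] by auto
    have "real_of_int k \<le> 3 ^ N * x" "3 ^ N * x \<le> real_of_int k + 1" unfolding k_def by linarith+
    then have "\<bar>3 ^ N * x - real_of_int k\<bar> \<le> 1" by linarith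
    moreover have "x - real_of_int k / 3 ^ N = (3 ^ N * x - real_of_int k) / 3 ^ N"
      by (simp add: field_simps)
    ultimately have "\<bar>x - real_of_int k / 3 ^ N\<bar> \<le> 1 / 3 ^ N"
      by (simp add: abs_divide divide_right_mono)
    then have "\<bar>y - x\<bar> < \<epsilon>" using y(1) N by linarith
    then show ?thesis using y(2) v(1) by blast
  qed
qed

text \<open>For the closure of \<open>h a\<close>: since labels move upwards, \<open>x\<close> belongs to \<open>h (R\<inverse> `` a)\<close> only if its label
  sees \<open>a\<close> at every stage, and then points near \<open>x\<close> eventually have a label in \<open>a\<close>. Conversely, if
  points of \<open>h a\<close> are arbitrarily close to \<open>x\<close>, then continuity at stage \<open>n\<close> shows that the label of
  \<open>x\<close> at stage \<open>n\<close> sees \<open>a\<close>.\<close>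
lemma embedding:
  obtains h where "alg_hom h (frame_alg W R) (space_alg euclideanreal)"
    "\<And>a. a \<subseteq> W \<Longrightarrow> h a = UNIV \<Longrightarrow> a = W"
proof -
  obtain U :: "nat set set" where U_compl: "\<And>A. - A \<in> U \<longleftrightarrow> A \<notin> U"
    and U_Int: "\<And>A B. A \<inter> B \<in> U \<longleftrightarrow> A \<in> U \<and> B \<in> U"
    and U_Un: "\<And>A B. A \<union> B \<in> U \<longleftrightarrow> A \<in> U \<or> B \<in> U"
    and U_tail: "\<And>n. {n..} \<in> U" and U_empty: "{} \<notin> U" and U_UNIV: "UNIV \<in> U"
    by (rule nonprincipal_ultrafilter) blast
  have U_mono: "B \<in> U" if "A \<in> U" "A \<subseteq> B" for A B
    using U_Un[of A B] that by (simp add: Un_absorb1)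
  have U_inf: "\<exists>m\<ge>n. m \<in> A" if "A \<in> U" for A n
  proof -
    have "A \<inter> {n..} \<noteq> {}" using U_Int that U_tail U_empty by metis
    then show ?thesis by auto
  qed
  define h where "h a = {x. {n. point_label n x \<in> a} \<in> U}" for a
  have ev: "y \<in> h a" if "v \<in> a" "\<forall>i\<ge>m. point_label i y = v" for y a v m
    unfolding h_def mem_Collect_eq by (rule U_mono[OF U_tail[of m]]) (use that in auto)
  have compl: "h (W - a) = UNIV - h a" for a
  proof -
    have "{n. point_label n x \<in> W - a} = - {n. point_label n x \<in> a}" for x using point_label_in by auto
    then show ?thesis using U_compl by (auto simp: h_def)
  qed
  have dia: "h (R\<inverse> `` a) = closure (h a)" for a
  proof (intro set_eqI iffI)
    fix x assume x: "x \<in> h (R\<inverse> `` a)"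
    have "point_label n x \<in> R\<inverse> `` a" for n
    proof -
      obtain m where "m \<ge> n" "point_label m x \<in> R\<inverse> `` a" using U_inf x by (force simp: h_def)
      then show ?thesis using point_label_mono R_trans by blast
    qed
    then show "x \<in> closure (h a)"
      unfolding closure_approachable dist_real_def using point_label_open[of x a] ev by blast
  next
    fix x assume x: "x \<in> closure (h a)"
    have "point_label n x \<in> R\<inverse> `` a" for n
    proof -
      obtain \<epsilon> where \<epsilon>: "\<epsilon> > 0" "\<And>y. \<bar>y - x\<bar> < \<epsilon> \<Longrightarrow> (point_label n x, point_label n y) \<in> R"
        using point_label_continuous by blast
      obtain y where y: "y \<in> h a" "\<bar>y - x\<bar> < \<epsilon>"
        using x \<epsilon>(1) unfolding closure_approachable dist_real_def by blast
      then obtain m where "m \<ge> n" "point_label m y \<in> a" using U_inf by (force simp: h_def)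
      then show ?thesis using \<epsilon>(2)[OF y(2)] point_label_mono R_trans by blast
    qed
    then show "x \<in> h (R\<inverse> `` a)" using U_UNIV by (simp add: h_def)
  qed
  have "alg_hom h (frame_alg W R) (space_alg euclideanreal)"
    unfolding alg_hom_def using compl dia point_label_in U_empty U_UNIV
    by (auto simp: h_def Collect_disj_eq U_Un Collect_conj_eq U_Int)
  moreover have "a = W" if a: "a \<subseteq> W" "h a = UNIV" for a
  proof (rule ccontr)
    assume "a \<noteq> W"
    then obtain k where "u k \<in> W - a" using a(1) u_range by blast
    moreover have "(cell_label 0 k, u k) \<in> R" using R_refl u_in by auto
    then obtain y m where "\<forall>i\<ge>m. point_label i y = u k" using realize_near(1)[of 0 k "u k" 0] by blast
    ultimately have "y \<in> h (W - a)" by (rule ev)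
    then show False using compl a(2) by blast
  qed
  ultimately show ?thesis by (rule that)
qed

end

lemma frame_imp_real_line:
  assumes "logic_of_countable_path_connected_frame TYPE('a) L"
  shows "\<exists>P. general_space euclideanreal P \<and> L = space_logic euclideanreal P"
proof -
  obtain W :: "'a set" and R P where F: "general_S4_frame W R P" "countable W" "path_connected_frame W R"
    "L = frame_logic W R P"
    using assms by (auto simp: logic_of_countable_path_connected_frame_def)
  have pre: "preorder_on W R" and ne: "W \<noteq> {}" and sub: "subalgebra P (frame_alg W R)"
    using F(1) by (simp_all add: general_S4_frame_def)
  have RW: "R \<subseteq> W \<times> W" and refl: "\<And>x. x \<in> W \<Longrightarrow> (x, x) \<in> R"
    using pre by (auto simp: preorder_on_def refl_on_def)
  obtain u :: "int \<Rightarrow> 'a" where u: "range u = W" "\<And>k. (u k, u (k + 1)) \<in> R \<or> (u (k + 1), u k) \<in> R"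
    using zigzag_sequence[OF F(2) ne F(3) RW refl] by blast
  \<comment> \<open>Decoding pairs makes every value occur infinitely often.\<close>
  define choice where "choice w n = from_nat_into (R `` {w}) (fst (prod_decode n))" for w n
  have cnt: "countable (R `` {w})" for w
    by (rule countable_subset[OF _ F(2)]) (use RW in auto)
  interpret line_labelling W R u choice
  proof
    show "(w, choice w n) \<in> R" if "w \<in> W" for w n
      using from_nat_into[of "R `` {w}"] refl[OF that] unfolding choice_def by blast
    show "\<exists>m\<ge>n. choice w m = v" if wv: "(w, v) \<in> R" for w v n
    proof -
      obtain i where "from_nat_into (R `` {w}) i = v"
        using from_nat_into_surj[OF cnt[of w], of v] wv by blast
      then have "choice w (prod_encode (i, n)) = v" by (simp add: choice_def)
      then show ?thesis using le_prod_encode_2 by blast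
    qed
  qed (use pre u in auto)
  obtain h where h: "alg_hom h (frame_alg W R) (space_alg euclideanreal)"
    "\<And>a. a \<subseteq> W \<Longrightarrow> h a = UNIV \<Longrightarrow> a = W" using embedding by blast
  have PW: "a \<subseteq> W" if "a \<in> P" for a using that sub by (auto simp: subalgebra_def)
  have "alg_hom h (frame_sub W R P) (space_alg euclideanreal)"
    using h(1) PW by (auto simp: alg_hom_def)
  from logic_of_hom_image[OF closed_alg_restrict[OF sub] this]
  have "subalgebra (h ` P) (space_alg euclideanreal)" "space_logic euclideanreal (h ` P) = L"
    using h(2) PW F(4) by (simp_all add: space_logic_def frame_logic_def)
  then show ?thesis by (auto simp: general_space_def)
qed

lemma connected_space_imp_connected_logic:
  assumes "logic_of_countable_connected_space TYPE('b) L"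
  shows "connected_logic TYPE('a::infinite) L"
  using assms connected_logic_of_space by (auto simp: logic_of_countable_connected_space_def)

lemma real_line_imp_connected_logic:
  assumes "\<exists>P. general_space euclideanreal P \<and> L = space_logic euclideanreal P"
  shows "connected_logic TYPE('a::infinite) L"
proof -
  have "connected_space euclideanreal" 
    using connected_UNIV[where 'a = real] connectedin_topspace[of euclideanreal]
    by (simp del: connectedin_topspace)
  then show ?thesis using assms connected_logic_of_space by auto
qed

theorem theorem9p1:
  fixes L :: "fm set"
  assumes "logic_above_S4 L"
  shows "(connected_logic TYPE('a::infinite) L \<longleftrightarrow>
            logic_of_countable_path_connected_frame TYPE('b::infinite) L) \<and>
         (logic_of_countable_path_connected_frame TYPE('b) L \<longleftrightarrow>
            logic_of_countable_connected_space TYPE('c::infinite) L) \<and>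
         (logic_of_countable_connected_space TYPE('c) L \<longleftrightarrow>
            (\<exists>P. general_space euclideanreal P \<and> L = space_logic euclideanreal P)) \<and>
         ((\<exists>P. general_space euclideanreal P \<and> L = space_logic euclideanreal P) \<longleftrightarrow>
            (\<exists>A. subalgebra A (space_alg euclideanreal) \<and>
                 L = logic_of (restrict_alg (space_alg euclideanreal) A)))"
proof -
  let ?real = "\<exists>P. general_space euclideanreal P \<and> L = space_logic euclideanreal P"
  have conn_b: "connected_logic TYPE('a) L" if "logic_of_countable_path_connected_frame TYPE('b) L"
    using that by (rule connected_space_imp_connected_logic[OF frame_imp_connected_space])
  have space_c: "logic_of_countable_connected_space TYPE('c) L" if "connected_logic TYPE('a) L"
    using that by (rule frame_imp_connected_space[OF connected_logic_imp_frame])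
  have frame_b: "logic_of_countable_path_connected_frame TYPE('b) L" if "connected_logic TYPE('a) L"
    using that by (rule connected_logic_imp_frame)
  have conn_c: "connected_logic TYPE('a) L" if "logic_of_countable_connected_space TYPE('c) L"
    using that by (rule connected_space_imp_connected_logic)
  have conn_real: "connected_logic TYPE('a) L" if ?real
    using that by (rule real_line_imp_connected_logic)
  have real_b: ?real if "logic_of_countable_path_connected_frame TYPE('b) L"
    using that by (rule frame_imp_real_line)
  have "?real \<longleftrightarrow> (\<exists>A. subalgebra A (space_alg euclideanreal) \<and>
      L = logic_of (restrict_alg (space_alg euclideanreal) A))"
    by (simp add: general_space_def space_logic_def)
  then show ?thesis using conn_b space_c frame_b conn_c conn_real real_b by argo
qed

end
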